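(* Consider the quasi-linear system described in the context, with stacked observation vector $Y=\mathrm{col}(y_0,\dots,y_N)$, mean $F(\theta,U)$ and covariance $S(\theta,U)$ of $Y$ given $\theta$. For $\theta\in\Theta$ and an input $U=\mathrm{col}(u_0,\dots,u_{N-1})$ write $A_k=A(\theta,u_k)$, $B_k=B(\theta,u_k)$, $G_k=G(\theta,u_k)$, and define recursively, starting from $m_0^-(\theta)$, $S_0^-(\theta)$, $$\Sigma_k(\theta)=S_v+C S_k^-(\theta)C^{\mathsf T},\qquad L_k(\theta)=S_k^-(\theta)C^{\mathsf T}\Sigma_k^{-1}(\theta),$$ $$m_k(\theta)=m_k^-(\theta)+L_k(\theta)\left(y_k-Cm_k^-(\theta)\right),\qquad S_k(\theta)=S_k^-(\theta)-L_k(\theta)\Sigma_k(\theta)L_k(\theta)^{\mathsf T}$$ for $k=0,\dots,N$, and $$m_{k+1}^-(\theta)=A_k m_k(\theta)+B_k,\qquad S_{k+1}^-(\theta)=A_kS_k(\theta)A_k^{\mathsf T}+G_kG_k^{\mathsf T}$$ for $k=0,\dots,N-1$. Then the following identities hold: $$p(Y\mid\theta,U)=\prod_{k=0}^N\mathcal{N}\left(y_k,\,Cm_k^-(\theta),\,\Sigma_k(\theta)\right),$$ $$|Y-F(\theta,U)|^2_{S(\theta,U)^{-1}}=\sum_{k=0}^N|y_k-Cm_k^-(\theta)|^2_{\Sigma_k^{-1}(\theta)},$$ $$|S(\theta,U)|=\prod_{k=0}^N|\Sigma_k(\theta)|,$$ $$\mathcal{L}(\theta,Y,U)=\tfrac12\sum_{k=0}^N\left(|y_k-Cm_k^-(\theta)|^2_{\Sigma_k^{-1}(\theta)}+\ln|\Sigma_k(\theta)|\right)-\ln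 p_0(\theta),$$ where $$\mathcal{L}(\theta,Y,U)=\tfrac12|Y-F(\theta,U)|^2_{S^{-1}(\theta,U)}+\tfrac12\ln|S(\theta,U)|-\ln p_0(\theta).$$
   Context: Notation: for a vector $x$ and a square matrix $Q$, $|x|_Q^2=x^{\mathsf T}Qx$; $|M|$ is the determinant of a square matrix $M$; $\mathbb{I}$ is an identity matrix ($\mathbb{I}_m$ of size $m$); $\mathrm{col}(\cdot)$ is vertical stacking; $\mathcal{N}(x,m,S)=(2\pi)^{-n/2}|S|^{-1/2}\exp\left(-\tfrac12(x-m)^{\mathsf T}S^{-1}(x-m)\right)$ is the Gaussian density on $\mathbb{R}^n$. Quasi-linear system: $\theta\in\Theta\subset\mathbb{R}^{n_\theta}$ has prior $p_0$ (the identity for $\mathcal{L}$ is meant for $\theta$ with $p_0(\theta)>0$), $N\geqslant1$, and $$x_{k+1}=A(\theta,u_k)x_k+B(\theta,u_k)+G(\theta,u_k)w_k\quad(k=0,\dots,N-1),\qquad y_k=Cx_k+v_k\quad(k=0,\dots,N),$$ with $x_k\in\mathbb{R}^n$, $y_k,v_k\in\mathbb{R}^{n_y}$, $w_k\in\mathbb{R}^{n_w}$, $w_k\sim\mathcal{N}(0,\mathbb{I})$, $v_k\sim\mathcal{N}(0,S_v)$, $S_v>0$ (positive definite). Given $\theta$, the variables $x_0,w_0,\dots,w_{N-1},v_0,\dots,v_N$ are mutually independent, and $p(x_0\mid\theta)=\mathcal{N}(x_0,m_0^-(\theta),S_0^-(\theta))$ with $m_0^-,S_0^-$ smooth and $S_0^-(\theta)>0$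 for all $\theta\in\Theta$. $A,B,G$ are matrix-valued functions of compatible dimensions ($B$ is $\mathbb{R}^n$-valued). The input sequence $U=\mathrm{col}(u_0,\dots,u_{N-1})$ is deterministic. Stacked form: let $\Phi(n,n)=\mathbb{I}$ and $\Phi(n,j)=A_{n-1}A_{n-2}\cdots A_j$ for $j<n$, with $A_k=A(\theta,u_k)$, $B_k=B(\theta,u_k)$, $G_k=G(\theta,u_k)$. Index block rows by $k=0,\dots,N$. $\mathcal{A}(\theta,U)$ has $k$-th block row $\Phi(k,0)$; $\mathcal{B}(\theta,U)$ has $k$-th block $\sum_{j=0}^{k-1}\Phi(k,j+1)B_j$; $\mathcal{G}(\theta,U)$ has $(k,j)$ block ($0\leqslant j\leqslant N-1$) equal to $\Phi(k,j+1)G_j$ if $j<k$ and $0$ otherwise; $\mathcal{C}=\mathbb{I}_{N+1}\otimes C$. Then $$F(\theta,U)=\mathcal{C}\mathcal{A}(\theta,U)m_0^-(\theta)+\mathcal{C}\mathcal{B}(\theta,U),$$ $$S(\theta,U)=\mathcal{C}\left(\mathcal{A}(\theta,U)S_0^-(\theta)\mathcal{A}(\theta,U)^{\mathsf T}+\mathcal{G}(\theta,U)\mathcal{G}(\theta,U)^{\mathsf T}\right)\mathcal{C}^{\mathsf T}+\mathbb{I}_{N+1}\otimes S_v,$$ and $p(Y\mid\theta,U)=\mathcal{N}(Y,F(\theta,U),S(\theta,U))$ is the conditional density of $Y=\mathrm{col}(y_0,\dots,y_N)$. *)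

theory Defs
  imports Complex_Main
    "Jordan_Normal_Form.Determinant"
    "Jordan_Normal_Form.Gauss_Jordan_Elimination"
begin

section \<open>Linear algebra and the Gaussian density\<close>

text \<open>Only meaningful for invertible square matrices (otherwise the value is unspecified).\<close>
definition inv_mat :: "real mat \<Rightarrow> real mat" where
  "inv_mat M = the (mat_inverse M)"

definition pos_def :: "nat \<Rightarrow> real mat \<Rightarrow> bool" where
  "pos_def d M \<longleftrightarrow> M \<in> carrier_mat d d \<and> M\<^sup>T = M \<and>
     (\<forall>x \<in> carrier_vec d. x \<noteq> 0\<^sub>v d \<longrightarrow> 0 < x \<bullet> (M *\<^sub>v x))"

definition wnorm_sq :: "real mat \<Rightarrow> real vec \<Rightarrow> real" where
  "wnorm_sq Q x = x \<bullet> (Q *\<^sub>v x)"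

definition gauss_density :: "real vec \<Rightarrow> real vec \<Rightarrow> real mat \<Rightarrow> real" where
  "gauss_density x m S =
     (2 * pi) powr (- real (dim_vec x) / 2) * det S powr (- 1 / 2) *
     exp (- 1 / 2 * wnorm_sq (inv_mat S) (x - m))"

definition col_stack :: "nat \<Rightarrow> nat \<Rightarrow> (nat \<Rightarrow> real vec) \<Rightarrow> real vec" where
  "col_stack K d f = vec (K * d) (\<lambda>i. f (i div d) $ (i mod d))"

text \<open>\<open>K \<times> J\<close> blocks, each of size \<open>r \<times> c\<close>; block \<open>(k, j)\<close> is \<open>f k j\<close>.\<close>
definition blocks_mat ::
    "nat \<Rightarrow> nat \<Rightarrow> nat \<Rightarrow> nat \<Rightarrow> (nat \<Rightarrow> nat \<Rightarrow> real mat) \<Rightarrow> real mat" where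
  "blocks_mat K J r c f =
     mat (K * r) (J * c) (\<lambda>(i, l). f (i div r) (l div c) $$ (i mod r, l mod c))"

definition kron :: "real mat \<Rightarrow> real mat \<Rightarrow> real mat" where
  "kron P Q = mat (dim_row P * dim_row Q) (dim_col P * dim_col Q)
     (\<lambda>(i, l). P $$ (i div dim_row Q, l div dim_col Q) * Q $$ (i mod dim_row Q, l mod dim_col Q))"

section \<open>The quasi-linear system\<close>

text \<open>
  The system is
    \<open>x (k + 1) = A \<theta> (u k) x k + B \<theta> (u k) + G \<theta> (u k) w k\<close>,
    \<open>y k = C x k + v k\<close>
  with independent \<open>w k ~ N(0, I)\<close>, \<open>v k ~ N(0, Sv)\<close> and
  \<open>x 0 ~ N(m0 \<theta>, S0 \<theta>)\<close> given \<open>\<theta>\<close>.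
  Inputs \<open>u k\<close> range over an arbitrary type \<open>'u\<close>.
\<close>
record 'u qlsys =
  dim_theta :: nat
  dim_x :: nat
  dim_y :: nat
  dim_w :: nat
  Theta :: "real vec set"
  prior :: "real vec \<Rightarrow> real"
  Amat :: "real vec \<Rightarrow> 'u \<Rightarrow> real mat"
  Bvec :: "real vec \<Rightarrow> 'u \<Rightarrow> real vec"
  Gmat :: "real vec \<Rightarrow> 'u \<Rightarrow> real mat"
  Cmat :: "real mat"
  Sv :: "real mat"
  m0 :: "real vec \<Rightarrow> real vec"
  S0 :: "real vec \<Rightarrow> real mat"

definition wf_qlsys :: "'u qlsys \<Rightarrow> bool" where
  "wf_qlsys Q \<longleftrightarrow>
     Theta Q \<subseteq> carrier_vec (dim_theta Q) \<and>
     (\<forall>\<theta> \<in> Theta Q. \<forall>u.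
        Amat Q \<theta> u \<in> carrier_mat (dim_x Q) (dim_x Q) \<and>
        Bvec Q \<theta> u \<in> carrier_vec (dim_x Q) \<and>
        Gmat Q \<theta> u \<in> carrier_mat (dim_x Q) (dim_w Q)) \<and>
     Cmat Q \<in> carrier_mat (dim_y Q) (dim_x Q) \<and>
     pos_def (dim_y Q) (Sv Q) \<and>
     (\<forall>\<theta> \<in> Theta Q. m0 Q \<theta> \<in> carrier_vec (dim_x Q) \<and> pos_def (dim_x Q) (S0 Q \<theta>))"

section \<open>Stacked form\<close>

text \<open>\<open>trans_mat Q \<theta> u k j = A (k-1) \<cdots> A j\<close> for \<open>j \<le> k\<close>; it is not used for \<open>k < j\<close>.\<close>
fun trans_mat :: "'u qlsys \<Rightarrow> real vec \<Rightarrow> (nat \<Rightarrow> 'u) \<Rightarrow> nat \<Rightarrow> nat \<Rightarrow> real mat" where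
  "trans_mat Q \<theta> u 0 j = 1\<^sub>m (dim_x Q)"
| "trans_mat Q \<theta> u (Suc k) j =
     (if j \<le> k then Amat Q \<theta> (u k) * trans_mat Q \<theta> u k j else 1\<^sub>m (dim_x Q))"

definition stacked_A :: "'u qlsys \<Rightarrow> nat \<Rightarrow> real vec \<Rightarrow> (nat \<Rightarrow> 'u) \<Rightarrow> real mat" where
  "stacked_A Q N \<theta> u =
     blocks_mat (N + 1) 1 (dim_x Q) (dim_x Q) (\<lambda>k _. trans_mat Q \<theta> u k 0)"

definition stacked_B :: "'u qlsys \<Rightarrow> nat \<Rightarrow> real vec \<Rightarrow> (nat \<Rightarrow> 'u) \<Rightarrow> real vec" where
  "stacked_B Q N \<theta> u =
     col_stack (N + 1) (dim_x Q)
       (\<lambda>k. finsum_vec TYPE(real) (dim_x Q)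
              (\<lambda>j. trans_mat Q \<theta> u k (j + 1) *\<^sub>v Bvec Q \<theta> (u j)) {..<k})"

definition stacked_G :: "'u qlsys \<Rightarrow> nat \<Rightarrow> real vec \<Rightarrow> (nat \<Rightarrow> 'u) \<Rightarrow> real mat" where
  "stacked_G Q N \<theta> u =
     blocks_mat (N + 1) N (dim_x Q) (dim_w Q)
       (\<lambda>k j. if j < k then trans_mat Q \<theta> u k (j + 1) * Gmat Q \<theta> (u j)
              else 0\<^sub>m (dim_x Q) (dim_w Q))"

definition stacked_C :: "'u qlsys \<Rightarrow> nat \<Rightarrow> real mat" where
  "stacked_C Q N = kron (1\<^sub>m (N + 1)) (Cmat Q)"

definition F_mean :: "'u qlsys \<Rightarrow> nat \<Rightarrow> real vec \<Rightarrow> (nat \<Rightarrow> 'u) \<Rightarrow> real vec" where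
  "F_mean Q N \<theta> u =
     stacked_C Q N * stacked_A Q N \<theta> u *\<^sub>v m0 Q \<theta> + stacked_C Q N *\<^sub>v stacked_B Q N \<theta> u"

definition S_cov :: "'u qlsys \<Rightarrow> nat \<Rightarrow> real vec \<Rightarrow> (nat \<Rightarrow> 'u) \<Rightarrow> real mat" where
  "S_cov Q N \<theta> u =
     stacked_C Q N *
       (stacked_A Q N \<theta> u * S0 Q \<theta> * (stacked_A Q N \<theta> u)\<^sup>T
        + stacked_G Q N \<theta> u * (stacked_G Q N \<theta> u)\<^sup>T) *
       (stacked_C Q N)\<^sup>T
     + kron (1\<^sub>m (N + 1)) (Sv Q)"

text \<open>
  The conditional density \<open>p(Y | \<theta>, U)\<close> of the stacked observations: given \<open>\<theta>\<close>,
  \<open>Y\<close> is an affine image of independent Gaussians, with mean \<open>F\<close> and covariance \<open>S\<close>.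
\<close>
definition obs_density ::
    "'u qlsys \<Rightarrow> nat \<Rightarrow> real vec \<Rightarrow> (nat \<Rightarrow> 'u) \<Rightarrow> real vec \<Rightarrow> real" where
  "obs_density Q N \<theta> u Y = gauss_density Y (F_mean Q N \<theta> u) (S_cov Q N \<theta> u)"

definition neg_log_post ::
    "'u qlsys \<Rightarrow> nat \<Rightarrow> real vec \<Rightarrow> real vec \<Rightarrow> (nat \<Rightarrow> 'u) \<Rightarrow> real" where
  "neg_log_post Q N \<theta> Y u =
     1 / 2 * wnorm_sq (inv_mat (S_cov Q N \<theta> u)) (Y - F_mean Q N \<theta> u)
     + 1 / 2 * ln (det (S_cov Q N \<theta> u)) - ln (prior Q \<theta>)"

section \<open>Kalman recursion\<close>

text \<open>In order: \<open>S\<^sub>k\<^sup>-\<close>, \<open>\<Sigma>\<^sub>k\<close>, \<open>L\<^sub>k\<close>, \<open>S\<^sub>k\<close>.\<close>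
fun pred_cov innov_cov gain filt_cov ::
    "'u qlsys \<Rightarrow> real vec \<Rightarrow> (nat \<Rightarrow> 'u) \<Rightarrow> nat \<Rightarrow> real mat" where
  "pred_cov Q \<theta> u 0 = S0 Q \<theta>"
| "pred_cov Q \<theta> u (Suc k) =
     Amat Q \<theta> (u k) * filt_cov Q \<theta> u k * (Amat Q \<theta> (u k))\<^sup>T
     + Gmat Q \<theta> (u k) * (Gmat Q \<theta> (u k))\<^sup>T"
| "innov_cov Q \<theta> u k = Sv Q + Cmat Q * pred_cov Q \<theta> u k * (Cmat Q)\<^sup>T"
| "gain Q \<theta> u k = pred_cov Q \<theta> u k * (Cmat Q)\<^sup>T * inv_mat (innov_cov Q \<theta> u k)"
| "filt_cov Q \<theta> u k =
     pred_cov Q \<theta> u k - gain Q \<theta> u k * innov_cov Q \<theta> u k * (gain Q \<theta> u k)\<^sup>T"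

text \<open>In order: \<open>m\<^sub>k\<^sup>-\<close>, \<open>m\<^sub>k\<close>.\<close>
fun pred_mean filt_mean ::
    "'u qlsys \<Rightarrow> real vec \<Rightarrow> (nat \<Rightarrow> 'u) \<Rightarrow> (nat \<Rightarrow> real vec) \<Rightarrow> nat \<Rightarrow> real vec" where
  "pred_mean Q \<theta> u y 0 = m0 Q \<theta>"
| "pred_mean Q \<theta> u y (Suc k) = Amat Q \<theta> (u k) *\<^sub>v filt_mean Q \<theta> u y k + Bvec Q \<theta> (u k)"
| "filt_mean Q \<theta> u y k =
     pred_mean Q \<theta> u y k + gain Q \<theta> u k *\<^sub>v (y k - Cmat Q *\<^sub>v pred_mean Q \<theta> u y k)"

end

(* The innovations e k = y k - C m_k^- are obtained from the residual Y - F by inverting a block unit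
   lower triangular matrix T with blocks T k j = C Phi(k, j) L_j (j < k), since the predicted mean is
   the prior mean corrected by the propagated terms A_j L_j e j.  The same T factorizes the
   covariance, S = T D T^T with D = blockdiag(Sigma_0, ..., Sigma_N): this amounts to telescoping
   the Riccati recursion.  Hence det S = det D, and |T e|^2 in the S^-1 norm is |e|^2 in the D^-1
   norm.  Positive definiteness of S_v keeps every Sigma_k invertible.

   For real arguments, ln and powr are multiplicative at negative values too (ln x = ln |x|), so
   the density and log-determinant formulas only need the determinants to be nonzero. *)
theory Submission
  imports Defs
begin

text \<open>The two sides count uncertainty differently. The stacked covariance adds up the process
  noise that entered before a given time, while \<open>T D T^T\<close> adds up the covariance
  removed by each measurement. They are matched block by block: block (k, l) of
  \<open>T D T^T\<close> is a sum over j up to \<open>min k l\<close>, whose last term carries the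
  predicted covariance at time \<open>min k l\<close> and whose earlier terms carry
  \<open>L_j \<Sigma>_j L_j^T\<close>. Telescoping converts exactly this combination into the prior
  covariance plus process noise. The obstacle is a circular dependence: the gain has meaning only if
  \<open>\<Sigma>_k\<close> is invertible, which relies on the predicted covariance being
  semidefinite, which in turn relies on the gains at earlier times. One induction over time settles
  both. Its invariant cannot be definiteness, since \<open>A_k\<close> and \<open>G_k\<close> may
  both be singular. No inverse of a stacked matrix is computed. The quadratic form comes from
  solving linear systems with \<open>T\<close>, \<open>D\<close> and \<open>T^T\<close>.\<close>

section \<open>Semidefinite matrices\<close>

text \<open>Unlike the library versions with \<open>carrier_mat\<close> premises, the following rules have no
  dimension variables in the premises, so the simplifier can discharge their side conditions.\<close>

lemma mult_assoc_dim:
  fixes A B C :: "'a :: semiring_0 mat"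
  assumes "dim_col A = dim_row B" "dim_col B = dim_row C"
  shows "(A * B) * C = A * (B * C)"
  by (rule assoc_mult_mat[OF carrier_matI[OF refl assms(1)] carrier_matI[OF refl assms(2)]
        carrier_matI[OF refl refl]])

lemma mult_vec_assoc_dim:
  fixes A B :: "'a :: semiring_0 mat"
  assumes "dim_col A = dim_row B" "dim_col B = dim_vec v"
  shows "(A * B) *\<^sub>v v = A *\<^sub>v (B *\<^sub>v v)"
  by (rule assoc_mult_mat_vec[OF carrier_matI[OF refl assms(1)] carrier_matI[OF refl assms(2)]
        carrier_vecI[OF refl]])

lemma add_mult_dim:
  fixes A B C :: "'a :: semiring_0 mat"
  assumes "dim_row A = dim_row B" "dim_col A = dim_col B" "dim_col B = dim_row C"
  shows "(A + B) * C = A * C + B * C"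
  by (rule add_mult_distrib_mat[OF carrier_matI[OF assms(1) trans[OF assms(2,3)]]
        carrier_matI[OF refl assms(3)] carrier_matI[OF refl refl]])

lemma mult_add_dim:
  fixes A B C :: "'a :: semiring_0 mat"
  assumes "dim_row B = dim_row C" "dim_col B = dim_col C" "dim_col A = dim_row C"
  shows "A * (B + C) = A * B + A * C"
  by (rule mult_add_distrib_mat[OF carrier_matI[OF refl assms(3)] carrier_matI[OF assms(1,2)]
        carrier_matI[OF refl refl]])

lemma minus_mult_dim:
  fixes A B C :: "'a :: ring mat"
  assumes "dim_row A = dim_row B" "dim_col A = dim_col B" "dim_col B = dim_row C"
  shows "(A - B) * C = A * C - B * C"
  by (rule minus_mult_distrib_mat[OF carrier_matI[OF assms(1) trans[OF assms(2,3)]]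
        carrier_matI[OF refl assms(3)] carrier_matI[OF refl refl]])

lemma mult_minus_dim:
  fixes A B C :: "'a :: ring mat"
  assumes "dim_row B = dim_row C" "dim_col B = dim_col C" "dim_col A = dim_row C"
  shows "A * (B - C) = A * B - A * C"
  by (rule mult_minus_distrib_mat[OF carrier_matI[OF refl assms(3)] carrier_matI[OF assms(1,2)]
        carrier_matI[OF refl refl]])

lemma transpose_mult_dim:
  fixes A B :: "'a :: comm_semiring_0 mat"
  assumes "dim_col A = dim_row B"
  shows "(A * B)\<^sup>T = B\<^sup>T * A\<^sup>T"
  by (rule transpose_mult[OF carrier_matI[OF refl assms] carrier_matI[OF refl refl]])

lemma transpose_add_dim:
  assumes "dim_row A = dim_row B" "dim_col A = dim_col B"
  shows "(A + B)\<^sup>T = A\<^sup>T + B\<^sup>T"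
  using assms by (intro eq_matI) auto

lemma transpose_minus_dim:
  assumes "dim_row A = dim_row B" "dim_col A = dim_col B"
  shows "(A - B)\<^sup>T = A\<^sup>T - B\<^sup>T"
  using assms by (intro eq_matI) auto

lemmas mat_dim_simps = mult_assoc_dim add_mult_dim mult_add_dim minus_mult_dim mult_minus_dim
  transpose_mult_dim transpose_add_dim transpose_minus_dim mult_vec_assoc_dim
  index_mult_mat(2,3) index_add_mat(2,3) index_minus_mat(2,3) index_one_mat(2,3)
  index_transpose_mat(2,3) transpose_transpose transpose_one dim_mult_mat_vec carrier_matD carrier_vecD

lemma scalar_prod_mult_transpose:
  fixes A :: "real mat"
  assumes "A \<in> carrier_mat n m" "x \<in> carrier_vec n" "z \<in> carrier_vec m"
  shows "x \<bullet> (A *\<^sub>v z) = (A\<^sup>T *\<^sub>v x) \<bullet> z"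
  using assms transpose_vec_mult_scalar[of A n m z x] by simp

text \<open>A nonzero determinant makes the matrix a unit, so \<open>mat_inverse\<close> returns
  \<open>Some\<close>; this is the only case in which \<open>inv_mat\<close> has a known
  value.\<close>

lemma inv_mat_props:
  assumes "M \<in> carrier_mat n n" "det M \<noteq> 0"
  shows "inv_mat M \<in> carrier_mat n n" "M * inv_mat M = 1\<^sub>m n" "inv_mat M * M = 1\<^sub>m n"
proof -
  have "M \<in> Units (ring_mat TYPE(real) n ())"
    using assms by (intro det_non_zero_imp_unit)
  with mat_inverse(1)[OF assms(1), of "()"] obtain B where B: "mat_inverse M = Some B"
    by (cases "mat_inverse M") auto
  with mat_inverse(2)[OF assms(1) B]
  show "inv_mat M \<in> carrier_mat n n" "M * inv_mat M = 1\<^sub>m n" "inv_mat M * M = 1\<^sub>m n"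
    by (auto simp: inv_mat_def)
qed

section \<open>Semidefinite matrices and the measurement update\<close>

text \<open>Symmetry is part of the notion because the factorization needs the transposed gain
  equation \<open>innov_cov_gain\<close>, which rests on symmetry of the predicted
  covariance.\<close>

definition pos_semidef :: "nat \<Rightarrow> real mat \<Rightarrow> bool" where
  "pos_semidef d M \<longleftrightarrow> M \<in> carrier_mat d d \<and> M\<^sup>T = M \<and> (\<forall>x \<in> carrier_vec d. 0 \<le> x \<bullet> (M *\<^sub>v x))"

lemma pos_def_imp_pos_semidef:
  assumes "pos_def d M" shows "pos_semidef d M"
proof -
  have "0 \<le> x \<bullet> (M *\<^sub>v x)" if "x \<in> carrier_vec d" for x
    using assms that by (cases "x = 0\<^sub>v d") (fastforce simp: pos_def_def)+
  then show ?thesis using assms by (auto simp: pos_def_def pos_semidef_def)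
qed

lemma pos_semidef_add:
  assumes "pos_semidef d M" "pos_semidef d N" shows "pos_semidef d (M + N)"
proof -
  have M: "M \<in> carrier_mat d d" and N: "N \<in> carrier_mat d d"
    using assms by (auto simp: pos_semidef_def)
  have "x \<bullet> ((M + N) *\<^sub>v x) = x \<bullet> (M *\<^sub>v x) + x \<bullet> (N *\<^sub>v x)" if "x \<in> carrier_vec d" for x
    using M N that by (subst add_mult_distrib_mat_vec[of _ d d]) (auto intro: scalar_prod_add_distrib)
  then show ?thesis
    using assms transpose_add[OF M N] by (simp add: pos_semidef_def)
qed

lemma pos_semidef_congruence:
  assumes "pos_semidef d M" and A: "A \<in> carrier_mat e d" shows "pos_semidef e (A * M * A\<^sup>T)"
proof -
  have M: "M \<in> carrier_mat d d" "M\<^sup>T = M" using assms by (auto simp: pos_semidef_def)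
  have "x \<bullet> (A * M * A\<^sup>T *\<^sub>v x) = (A\<^sup>T *\<^sub>v x) \<bullet> (M *\<^sub>v (A\<^sup>T *\<^sub>v x))" if x: "x \<in> carrier_vec e" for x
  proof -
    have "A * M * A\<^sup>T *\<^sub>v x = A *\<^sub>v (M *\<^sub>v (A\<^sup>T *\<^sub>v x))"
      using M(1) A x by (simp only: mat_dim_simps)
    moreover have "M *\<^sub>v (A\<^sup>T *\<^sub>v x) \<in> carrier_vec d"
      using mult_mat_vec_carrier[OF M(1) mult_mat_vec_carrier[OF _ x]] A by simp
    ultimately show ?thesis using scalar_prod_mult_transpose[OF A x] by simp
  qed
  moreover have "A\<^sup>T *\<^sub>v x \<in> carrier_vec d" for x
    using A by (intro carrier_vecI) simp
  moreover have "(A * M * A\<^sup>T)\<^sup>T = A * M * A\<^sup>T"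
    using M A by (simp only: mat_dim_simps)
  moreover have "A * M * A\<^sup>T \<in> carrier_mat e e"
    using M A by simp
  ultimately show ?thesis using assms(1) by (simp add: pos_semidef_def)
qed

lemma pos_semidef_one: "pos_semidef d (1\<^sub>m d)"
  by (auto simp: pos_semidef_def scalar_prod_def intro!: sum_nonneg)

lemma pos_semidef_gram:
  assumes "A \<in> carrier_mat e d" shows "pos_semidef e (A * A\<^sup>T)"
  using pos_semidef_congruence[OF pos_semidef_one assms] assms by simp

text \<open>A nonzero kernel vector v of \<open>R + M\<close> would give 0 = v.Rv + v.Mv >
  0.\<close>

lemma pos_def_add_pos_semidef:
  assumes R: "pos_def d R" and M: "pos_semidef d M"
  shows "det (R + M) \<noteq> 0"
proof
  assume "det (R + M) = 0"
  moreover have c: "R \<in> carrier_mat d d" "M \<in> carrier_mat d d"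
    using assms by (auto simp: pos_def_def pos_semidef_def)
  ultimately obtain v where v: "v \<in> carrier_vec d" "v \<noteq> 0\<^sub>v d" "(R + M) *\<^sub>v v = 0\<^sub>v d"
    using det_0_iff_vec_prod_zero[of "R + M" d] by auto
  have "v \<bullet> ((R + M) *\<^sub>v v) = v \<bullet> (R *\<^sub>v v) + v \<bullet> (M *\<^sub>v v)"
    using c v(1) by (subst add_mult_distrib_mat_vec[of _ d d]) (auto intro: scalar_prod_add_distrib)
  moreover have "v \<bullet> (R *\<^sub>v v) > 0" "v \<bullet> (M *\<^sub>v v) \<ge> 0"
    using R M v(1,2) by (auto simp: pos_def_def pos_semidef_def)
  ultimately show False using v by simp
qed

text \<open>Joseph's form \<open>(I - L C) P (I - L C)\<^sup>T + L R L\<^sup>T\<close> of the filtered covariance makes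
  semidefiniteness evident.\<close>
lemma pos_semidef_measurement_update:
  assumes P: "pos_semidef n P" and R: "pos_def d R" and C: "C \<in> carrier_mat d n"
    and S: "S = R + C * P * C\<^sup>T" and L: "L \<in> carrier_mat n d" and LS: "L * S = P * C\<^sup>T"
  shows "pos_semidef n (P - L * S * L\<^sup>T)"
proof -
  have c: "P \<in> carrier_mat n n" "P\<^sup>T = P" "R \<in> carrier_mat d d" "R\<^sup>T = R"
    using P R by (auto simp: pos_semidef_def pos_def_def)
  have Sc: "S \<in> carrier_mat d d"
    using c C by (simp add: S)
  have "S\<^sup>T = S"
    using c C by (simp only: S mat_dim_simps)
  have CP: "C * P = S * L\<^sup>T"
    using arg_cong[OF LS, of transpose_mat] L c C Sc \<open>S\<^sup>T = S\<close> by (simp only: mat_dim_simps)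
  \<comment> \<open>\<open>U\<close> and \<open>W\<close> are the two parts of
    \<open>L S L^T\<close> coming from \<open>S = R + C P C^T\<close>. By \<open>LS\<close> and its
    transpose, both cross terms \<open>P C^T L^T\<close> and \<open>L C P\<close> of Joseph's form
    equal \<open>U + W\<close>, so that form becomes P - (U + W) - (U + W) + W + U.\<close>
  define U W where "U = L * (R * L\<^sup>T)" and "W = L * (C * (P * (C\<^sup>T * L\<^sup>T)))"
  have UW: "U \<in> carrier_mat n n" "W \<in> carrier_mat n n"
    using c C L by (simp_all add: U_def W_def)
  have X: "L * (S * L\<^sup>T) = U + W"
    using c C L by (simp only: S U_def W_def mat_dim_simps)
  have "P * (C\<^sup>T * L\<^sup>T) = (P * C\<^sup>T) * L\<^sup>T"
    using c C L by (simp only: mat_dim_simps)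
  also have "\<dots> = U + W" unfolding LS[symmetric] X[symmetric]
    using Sc L by (simp only: mat_dim_simps)
  finally have X1: "P * (C\<^sup>T * L\<^sup>T) = U + W" .
  have X2: "L * (C * P) = U + W" by (simp add: CP X)
  have "(1\<^sub>m n - L * C) * P * (1\<^sub>m n - L * C)\<^sup>T + L * R * L\<^sup>T = P - (U + W) - ((U + W) - W) + U"
  proof -
    have "(1\<^sub>m n - L * C) * P * (1\<^sub>m n - L * C)\<^sup>T + L * R * L\<^sup>T
        = (1\<^sub>m n * P * 1\<^sub>m n - L * (C * P) * 1\<^sub>m n - (1\<^sub>m n * (P * (C\<^sup>T * L\<^sup>T)) - W)) + U"
      using c C L by (simp only: mat_dim_simps U_def W_def)
    also have "1\<^sub>m n * P * 1\<^sub>m n = P"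
      using c by simp
    also have "L * (C * P) * 1\<^sub>m n = U + W"
      unfolding X2 using UW by simp
    also have "1\<^sub>m n * (P * (C\<^sup>T * L\<^sup>T)) = U + W"
      unfolding X1 using UW by simp
    finally show ?thesis .
  qed
  also have "\<dots> = P - (U + W)"
    using c UW by (intro eq_matI) auto
  also have "\<dots> = P - L * S * L\<^sup>T"
    unfolding X[symmetric] using L Sc by (simp only: mat_dim_simps)
  finally show ?thesis
    using pos_semidef_add[OF pos_semidef_congruence[OF P, of "1\<^sub>m n - L * C" n]
        pos_semidef_congruence[OF pos_def_imp_pos_semidef[OF R] L]] L C
    by (simp add: minus_carrier_mat)
qed

section \<open>Block matrices\<close>

text \<open>The shape is an argument because an empty sum must still be a zero matrix of the right
  size; this occurs in every block with \<open>min k l = 0\<close>. The entrywise form makes the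
  carrier property unconditional.\<close>

definition mat_sum :: "nat \<Rightarrow> nat \<Rightarrow> (nat \<Rightarrow> real mat) \<Rightarrow> nat \<Rightarrow> real mat" where
  "mat_sum r c f J = mat r c (\<lambda>p. \<Sum>j<J. f j $$ p)"

lemma mat_sum_carrier [simp]: "mat_sum r c f J \<in> carrier_mat r c"
  and mat_sum_dim [simp]: "dim_row (mat_sum r c f J) = r" "dim_col (mat_sum r c f J) = c"
  by (simp_all add: mat_sum_def)

lemma mat_sum_0: "mat_sum r c f 0 = 0\<^sub>m r c"
  by (intro eq_matI) (simp_all add: mat_sum_def)

lemma mat_sum_Suc:
  assumes "f J \<in> carrier_mat r c"
  shows "mat_sum r c f (Suc J) = mat_sum r c f J + f J"
  using assms by (intro eq_matI) (simp_all add: mat_sum_def)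

lemma mat_sum_cong:
  assumes "\<And>j. j < J \<Longrightarrow> f j = g j"
  shows "mat_sum r c f J = mat_sum r c g J"
  unfolding mat_sum_def using assms by (intro cong_mat) simp_all

text \<open>This is how block triangularity enters the products: for two lower triangular factors
  the sum over the inner block index stops near \<open>min k l\<close>.\<close>

lemma mat_sum_truncate:
  assumes "J \<le> J'" and "\<And>j. J \<le> j \<Longrightarrow> j < J' \<Longrightarrow> f j = 0\<^sub>m r c"
  shows "mat_sum r c f J' = mat_sum r c f J"
proof (intro eq_matI)
  fix a b assume ab: "a < dim_row (mat_sum r c f J)" "b < dim_col (mat_sum r c f J)"
  have "(\<Sum>j<J'. f j $$ (a, b)) = (\<Sum>j<J. f j $$ (a, b))"
    using assms ab by (intro sum.mono_neutral_right) auto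
  then show "mat_sum r c f J' $$ (a, b) = mat_sum r c f J $$ (a, b)"
    using ab by (simp add: mat_sum_def)
qed simp_all

lemma mat_sum_single:
  assumes "k < J" and "\<And>j. j < J \<Longrightarrow> j \<noteq> k \<Longrightarrow> f j = 0\<^sub>m r c" and "f k \<in> carrier_mat r c"
  shows "mat_sum r c f J = f k"
proof (intro eq_matI)
  fix a b assume ab: "a < dim_row (f k)" "b < dim_col (f k)"
  have "(\<Sum>j<J. f j $$ (a, b)) = (\<Sum>j\<in>{k}. f j $$ (a, b))"
    using assms ab by (intro sum.mono_neutral_right) auto
  then show "mat_sum r c f J $$ (a, b) = f k $$ (a, b)"
    using ab assms(3) by (simp add: mat_sum_def)
qed (use assms(3) in simp_all)

lemma mult_mat_sum:
  assumes M: "M \<in> carrier_mat p r" and f: "\<And>j. j < J \<Longrightarrow> f j \<in> carrier_mat r c"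
  shows "M * mat_sum r c f J = mat_sum p c (\<lambda>j. M * f j) J"
  using f
proof (induction J)
  case 0 show ?case using M by (simp add: mat_sum_0)
next
  case (Suc J)
  have "M * f J \<in> carrier_mat p c" using Suc.prems M by simp
  with Suc M show ?case by (simp add: mat_sum_Suc mult_add_distrib_mat[of _ p r _ c])
qed

lemma mat_sum_mult:
  assumes M: "M \<in> carrier_mat c p" and f: "\<And>j. j < J \<Longrightarrow> f j \<in> carrier_mat r c"
  shows "mat_sum r c f J * M = mat_sum r p (\<lambda>j. f j * M) J"
  using f
proof (induction J)
  case 0 show ?case using M by (simp add: mat_sum_0)
next
  case (Suc J)
  have "f J * M \<in> carrier_mat r p"
    using Suc.prems M by (intro mult_carrier_mat) simp_all
  with Suc M show ?case by (simp add: mat_sum_Suc add_mult_distrib_mat[of _ r c _ _ p])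
qed

text \<open>It has the same form as the sums in \<open>stacked_B\<close>, so the stacked drift is
  recognised by unfolding alone.\<close>

definition vec_sum :: "nat \<Rightarrow> (nat \<Rightarrow> real vec) \<Rightarrow> nat \<Rightarrow> real vec" where
  "vec_sum r f J = finsum_vec TYPE(real) r f {..<J}"

lemma vec_sum_0 [simp]: "vec_sum r f 0 = 0\<^sub>v r"
  by (simp add: vec_sum_def finsum_vec_empty)

lemma vec_sum_carrier:
  assumes "\<And>j. j < J \<Longrightarrow> f j \<in> carrier_vec r"
  shows "vec_sum r f J \<in> carrier_vec r"
  unfolding vec_sum_def using assms by (intro finsum_vec_closed) auto

lemma vec_sum_Suc:
  assumes "\<And>j. j \<le> J \<Longrightarrow> f j \<in> carrier_vec r"
  shows "vec_sum r f (Suc J) = f J + vec_sum r f J"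
proof -
  have "f \<in> {..<J} \<rightarrow> carrier_vec r" using assms by auto
  then show ?thesis
    unfolding vec_sum_def lessThan_Suc using assms by (intro finsum_vec_insert) auto
qed

lemma vec_sum_cong:
  assumes "\<And>j. j < J \<Longrightarrow> f j = g j" "\<And>j. j < J \<Longrightarrow> g j \<in> carrier_vec r"
  shows "vec_sum r f J = vec_sum r g J"
  using assms by (induction J) (simp_all add: vec_sum_Suc)

lemma vec_sum_truncate:
  assumes "J \<le> J'" and "\<And>j. j < J \<Longrightarrow> f j \<in> carrier_vec r"
    and "\<And>j. J \<le> j \<Longrightarrow> j < J' \<Longrightarrow> f j = 0\<^sub>v r"
  shows "vec_sum r f J' = vec_sum r f J"
  using assms
proof (induction J' rule: dec_induct)
  case base show ?case ..
next
  case (step m)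
  have c: "f j \<in> carrier_vec r" if "j \<le> m" for j
    using step.prems that by (cases "j < J") auto
  have "vec_sum r f (Suc m) = f m + vec_sum r f m"
    using c by (rule vec_sum_Suc)
  moreover have "vec_sum r f m \<in> carrier_vec r"
    using c by (intro vec_sum_carrier) simp
  ultimately show ?case using step by simp
qed

lemma mult_vec_sum:
  assumes M: "M \<in> carrier_mat p r" and f: "\<And>j. j < J \<Longrightarrow> f j \<in> carrier_vec r"
  shows "M *\<^sub>v vec_sum r f J = vec_sum p (\<lambda>j. M *\<^sub>v f j) J"
  using f
proof (induction J)
  case 0 show ?case using M by (intro eq_vecI) (auto simp: scalar_prod_def)
next
  case (Suc J)
  have c: "\<And>j. j \<le> J \<Longrightarrow> M *\<^sub>v f j \<in> carrier_vec p" using Suc.prems M by simp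
  have "vec_sum r f J \<in> carrier_vec r" using Suc.prems by (intro vec_sum_carrier) simp
  then have "M *\<^sub>v (f J + vec_sum r f J) = M *\<^sub>v f J + M *\<^sub>v vec_sum r f J"
    using Suc.prems M by (intro mult_add_distrib_mat_vec) simp_all
  with Suc show ?case using vec_sum_Suc[of J "\<lambda>j. M *\<^sub>v f j" p] c
    by (simp add: vec_sum_Suc)
qed

section \<open>Stacked indices and block arithmetic\<close>

text \<open>Euclidean division by \<open>c\<close> reads a stacked index as block number and offset;
  the induction splits off the last block. For \<open>c = 0\<close> both sides are 0, so empty
  state, noise or observation spaces are covered.\<close>

lemma sum_div_mod:
  fixes h :: "nat \<Rightarrow> nat \<Rightarrow> 'a :: comm_monoid_add"
  shows "(\<Sum>t<J * c. h (t div c) (t mod c)) = (\<Sum>j<J. \<Sum>t<c. h j t)"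
proof (induction J)
  case (Suc J)
  have "(\<Sum>t<Suc J * c. h (t div c) (t mod c)) =
      (\<Sum>t<J * c. h (t div c) (t mod c)) + (\<Sum>t=0 + J * c..<c + J * c. h (t div c) (t mod c))"
    using sum.atLeastLessThan_concat[of 0 "J * c" "c + J * c" "\<lambda>t. h (t div c) (t mod c)"]
    by (simp add: lessThan_atLeast0)
  also have "(\<Sum>t=0 + J * c..<c + J * c. h (t div c) (t mod c)) = (\<Sum>t<c. h J t)"
    unfolding sum.shift_bounds_nat_ivl atLeast0LessThan
    by (intro sum.cong refl) simp
  finally show ?case using Suc by simp
qed simp

lemma blocks_mat_carrier [simp]: "blocks_mat K J r c f \<in> carrier_mat (K * r) (J * c)"
  and blocks_mat_dim [simp]: "dim_row (blocks_mat K J r c f) = K * r" "dim_col (blocks_mat K J r c f) = J * c"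
  by (simp_all add: blocks_mat_def)

lemma col_stack_carrier [simp]: "col_stack K d f \<in> carrier_vec (K * d)"
  and col_stack_dim [simp]: "dim_vec (col_stack K d f) = K * d"
  by (simp_all add: col_stack_def)

text \<open>The bound on \<open>i\<close> itself forces \<open>r > 0\<close>, so offsets lie inside
  their block although dimensions may be 0 in general.\<close>

lemma block_index_less:
  fixes i K r :: nat
  assumes "i < K * r"
  shows "i div r < K" "i mod r < r"
proof -
  show "i div r < K" using assms by (simp add: less_mult_imp_div_less)
  have "r > 0" using assms by (cases r) auto
  then show "i mod r < r" by simp
qed

lemma blocks_mat_index:
  assumes "i < K * r" "l < J * c"
  shows "blocks_mat K J r c f $$ (i, l) = f (i div r) (l div c) $$ (i mod r, l mod c)"
  using assms by (simp add: blocks_mat_def)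

lemma col_stack_index:
  assumes "i < K * r"
  shows "col_stack K r f $ i = f (i div r) $ (i mod r)"
  using assms by (simp add: col_stack_def)

lemma blocks_mat_cong:
  assumes "\<And>k j. k < K \<Longrightarrow> j < J \<Longrightarrow> f k j = g k j"
  shows "blocks_mat K J r c f = blocks_mat K J r c g"
  by (intro eq_matI) (simp_all add: blocks_mat_index block_index_less assms)

lemma col_stack_cong:
  assumes "\<And>k. k < K \<Longrightarrow> f k = g k"
  shows "col_stack K r f = col_stack K r g"
  by (intro eq_vecI) (simp_all add: col_stack_index block_index_less assms)

text \<open>\<open>sum_div_mod\<close> regroups the inner product of a row and a column by blocks,
  and each group is an entry of a product of two blocks.\<close>

lemma blocks_mat_mult:
  assumes f: "\<And>k j. k < K \<Longrightarrow> j < J \<Longrightarrow> f k j \<in> carrier_mat r c"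
    and g: "\<And>j m. j < J \<Longrightarrow> m < M \<Longrightarrow> g j m \<in> carrier_mat c s"
  shows "blocks_mat K J r c f * blocks_mat J M c s g =
    blocks_mat K M r s (\<lambda>k m. mat_sum r s (\<lambda>j. f k j * g j m) J)" (is "?l = ?r")
proof (rule eq_matI)
  fix i l assume "i < dim_row ?r" "l < dim_col ?r"
  then have il: "i < K * r" "l < M * s" by simp_all
  note b = block_index_less[OF il(1)] block_index_less[OF il(2)]
  have "?l $$ (i, l) = (\<Sum>t<J * c. blocks_mat K J r c f $$ (i, t) * blocks_mat J M c s g $$ (t, l))"
    using il by (simp add: scalar_prod_def atLeast0LessThan)
  also have "\<dots> = (\<Sum>t<J * c. f (i div r) (t div c) $$ (i mod r, t mod c)
      * g (t div c) (l div s) $$ (t mod c, l mod s))"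
    using il by (intro sum.cong) (simp_all add: blocks_mat_index)
  also have "\<dots> = (\<Sum>j<J. \<Sum>t<c. f (i div r) j $$ (i mod r, t) * g j (l div s) $$ (t, l mod s))"
    by (rule sum_div_mod)
  also have "\<dots> = (\<Sum>j<J. (f (i div r) j * g j (l div s)) $$ (i mod r, l mod s))"
  proof (intro sum.cong refl)
    fix j assume "j \<in> {..<J}"
    then have "f (i div r) j \<in> carrier_mat r c" "g j (l div s) \<in> carrier_mat c s"
      using f g b by simp_all
    then show "(\<Sum>t<c. f (i div r) j $$ (i mod r, t) * g j (l div s) $$ (t, l mod s)) =
        (f (i div r) j * g j (l div s)) $$ (i mod r, l mod s)"
      using b by (simp add: scalar_prod_def atLeast0LessThan)
  qed
  also have "\<dots> = ?r $$ (i, l)"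
    using il b by (simp add: blocks_mat_index mat_sum_def)
  finally show "?l $$ (i, l) = ?r $$ (i, l)" .
qed simp_all

lemma blocks_mat_mult_vec:
  assumes f: "\<And>k j. k < K \<Longrightarrow> j < J \<Longrightarrow> f k j \<in> carrier_mat r c"
    and x: "\<And>j. j < J \<Longrightarrow> x j \<in> carrier_vec c"
  shows "blocks_mat K J r c f *\<^sub>v col_stack J c x = col_stack K r (\<lambda>k. vec_sum r (\<lambda>j. f k j *\<^sub>v x j) J)"
    (is "?l = ?r")
proof (rule eq_vecI)
  fix i assume "i < dim_vec ?r"
  then have i: "i < K * r" by simp
  note b = block_index_less[OF i]
  have "?l $ i = (\<Sum>t<J * c. blocks_mat K J r c f $$ (i, t) * col_stack J c x $ t)"
    using i by (simp add: scalar_prod_def atLeast0LessThan)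
  also have "\<dots> = (\<Sum>t<J * c. f (i div r) (t div c) $$ (i mod r, t mod c) * x (t div c) $ (t mod c))"
    using i by (intro sum.cong) (simp_all add: blocks_mat_index col_stack_index)
  also have "\<dots> = (\<Sum>j<J. \<Sum>t<c. f (i div r) j $$ (i mod r, t) * x j $ t)"
    by (rule sum_div_mod)
  also have "\<dots> = (\<Sum>j<J. (f (i div r) j *\<^sub>v x j) $ (i mod r))"
  proof (intro sum.cong refl)
    fix j assume "j \<in> {..<J}"
    then have "f (i div r) j \<in> carrier_mat r c" "x j \<in> carrier_vec c"
      using f x b by simp_all
    then show "(\<Sum>t<c. f (i div r) j $$ (i mod r, t) * x j $ t) = (f (i div r) j *\<^sub>v x j) $ (i mod r)"
      using b by (simp add: scalar_prod_def atLeast0LessThan)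
  qed
  also have "\<dots> = vec_sum r (\<lambda>j. f (i div r) j *\<^sub>v x j) J $ (i mod r)"
    unfolding vec_sum_def
    by (rule index_finsum_vec[symmetric]) (use b f x in \<open>auto intro!: mult_mat_vec_carrier\<close>)
  also have "\<dots> = ?r $ i"
    using i by (simp add: col_stack_index)
  finally show "?l $ i = ?r $ i" .
qed simp_all

lemma blocks_mat_transpose:
  assumes f: "\<And>k j. k < K \<Longrightarrow> j < J \<Longrightarrow> f k j \<in> carrier_mat r c"
  shows "(blocks_mat K J r c f)\<^sup>T = blocks_mat J K c r (\<lambda>j k. (f k j)\<^sup>T)" (is "?l = ?r")
proof (rule eq_matI)
  fix i l assume "i < dim_row ?r" "l < dim_col ?r"
  then have il: "i < J * c" "l < K * r" by simp_all
  note b = block_index_less[OF il(1)] block_index_less[OF il(2)]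
  with f[of "l div r" "i div c"] show "?l $$ (i, l) = ?r $$ (i, l)"
    using il by (simp add: blocks_mat_index)
qed simp_all

lemma blocks_mat_add:
  assumes g: "\<And>k j. k < K \<Longrightarrow> j < J \<Longrightarrow> g k j \<in> carrier_mat r c"
  shows "blocks_mat K J r c f + blocks_mat K J r c g = blocks_mat K J r c (\<lambda>k j. f k j + g k j)"
    (is "?l = ?r")
proof (rule eq_matI)
  fix i l assume "i < dim_row ?r" "l < dim_col ?r"
  then have il: "i < K * r" "l < J * c" by simp_all
  note b = block_index_less[OF il(1)] block_index_less[OF il(2)]
  with g[of "i div r" "l div c"] show "?l $$ (i, l) = ?r $$ (i, l)"
    using il by (simp add: blocks_mat_index)
qed simp_all

lemma col_stack_add:
  assumes g: "\<And>k. k < K \<Longrightarrow> g k \<in> carrier_vec r"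
  shows "col_stack K r f + col_stack K r g = col_stack K r (\<lambda>k. f k + g k)" (is "?l = ?r")
proof (rule eq_vecI)
  fix i assume "i < dim_vec ?r"
  then have i: "i < K * r" by simp
  note b = block_index_less[OF i]
  with g[of "i div r"] show "?l $ i = ?r $ i"
    using i by (simp add: col_stack_index)
qed simp_all

lemma col_stack_minus:
  assumes g: "\<And>k. k < K \<Longrightarrow> g k \<in> carrier_vec r"
  shows "col_stack K r f - col_stack K r g = col_stack K r (\<lambda>k. f k - g k)" (is "?l = ?r")
proof (rule eq_vecI)
  fix i assume "i < dim_vec ?r"
  then have i: "i < K * r" by simp
  note b = block_index_less[OF i]
  with g[of "i div r"] show "?l $ i = ?r $ i"
    using i by (simp add: col_stack_index)
qed simp_all

lemma scalar_prod_col_stack: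
  assumes g: "\<And>k. k < K \<Longrightarrow> g k \<in> carrier_vec r"
  shows "col_stack K r f \<bullet> col_stack K r g = (\<Sum>k<K. f k \<bullet> g k)"
proof -
  have "col_stack K r f \<bullet> col_stack K r g
      = (\<Sum>t<K * r. f (t div r) $ (t mod r) * g (t div r) $ (t mod r))"
    unfolding scalar_prod_def by (simp add: atLeast0LessThan col_stack_index)
  also have "\<dots> = (\<Sum>k<K. \<Sum>t<r. f k $ t * g k $ t)"
    by (rule sum_div_mod)
  also have "\<dots> = (\<Sum>k<K. f k \<bullet> g k)"
  proof (intro sum.cong refl)
    fix k assume "k \<in> {..<K}"
    then have "dim_vec (g k) = r" using g by simp
    then show "(\<Sum>t<r. f k $ t * g k $ t) = f k \<bullet> g k"
      by (simp add: scalar_prod_def atLeast0LessThan)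
  qed
  finally show ?thesis .
qed

lemma blocks_mat_single:
  assumes "M \<in> carrier_mat r c"
  shows "blocks_mat 1 1 r c (\<lambda>_ _. M) = M"
  using assms by (intro eq_matI) (simp_all add: blocks_mat_index)

lemma col_stack_single:
  assumes "v \<in> carrier_vec r"
  shows "col_stack 1 r (\<lambda>_. v) = v"
  using assms by (intro eq_vecI) (simp_all add: col_stack_index)

lemma kron_one:
  assumes "M \<in> carrier_mat r c"
  shows "kron (1\<^sub>m K) M = blocks_mat K K r c (\<lambda>k j. if k = j then M else 0\<^sub>m r c)" (is "?l = ?r")
proof (rule eq_matI)
  fix i l assume "i < dim_row ?r" "l < dim_col ?r"
  then have il: "i < K * r" "l < K * c" by simp_all
  note b = block_index_less[OF il(1)] block_index_less[OF il(2)]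
  then show "?l $$ (i, l) = ?r $$ (i, l)"
    using il assms by (simp add: blocks_mat_index kron_def)
qed (use assms in \<open>simp_all add: kron_def\<close>)

section \<open>Determinants and quadratic forms of factorized matrices\<close>

text \<open>The last diagonal block is split off as the lower right corner of a four-block matrix
  with zero off-diagonal corners, whose determinant is a product.\<close>

lemma det_blocks_mat_diag:
  assumes "\<And>k. k < K \<Longrightarrow> M k \<in> carrier_mat d d"
  shows "det (blocks_mat K K d d (\<lambda>k j. if k = j then M k else 0\<^sub>m d d)) = (\<Prod>k<K. det (M k))"
  using assms
proof (induction K)
  case 0
  show ?case by (simp add: det_dim_zero[of _ ] blocks_mat_def)
next
  case (Suc K)
  let ?f = "\<lambda>k j. if k = j then M k else 0\<^sub>m d d"
  let ?B = "four_block_mat (blocks_mat K K d d ?f) (0\<^sub>m (K * d) d) (0\<^sub>m d (K * d)) (M K)"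
  have MK: "M K \<in> carrier_mat d d" using Suc.prems by simp
  have "blocks_mat (Suc K) (Suc K) d d ?f = ?B"
  proof (rule eq_matI)
    fix i l assume "i < dim_row ?B" "l < dim_col ?B"
    then have il: "i < Suc K * d" "l < Suc K * d" using MK by (simp_all add: add.commute)
    note b = block_index_less[OF il(1)] block_index_less[OF il(2)]
    have d: "0 < d" using il by (cases d) auto
    have last: "t div d = K \<and> t mod d = t - K * d" if "t < Suc K * d" "\<not> t < K * d" for t
    proof -
      define s where "s = t - K * d"
      have "t = s + K * d" "s < d" using that by (auto simp: s_def)
      then show ?thesis by simp
    qed
    have early: "t div d < K" if "t < K * d" for t using that by (rule block_index_less)
    show "blocks_mat (Suc K) (Suc K) d d ?f $$ (i, l) = ?B $$ (i, l)"
      using il MK last[of i] last[of l] early[of i] early[of l] b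
      by (cases "i < K * d"; cases "l < K * d") (auto simp: blocks_mat_index)
  qed (use MK in simp_all)
  moreover have "det ?B = det (blocks_mat K K d d ?f) * det (M K)"
    by (rule det_four_block_mat_upper_right_zero[where n = "K * d" and m = d]) (use MK in simp_all)
  ultimately show ?case using Suc by simp
qed

text \<open>Such a matrix is also lower triangular entry by entry: an entry with i < l lies either
  in a block above the diagonal or off the diagonal of an identity block. Its diagonal consists of
  ones.\<close>

lemma det_blocks_mat_unit_lower:
  assumes "\<And>k. k < K \<Longrightarrow> T k k = 1\<^sub>m d" and "\<And>k j. k < j \<Longrightarrow> j < K \<Longrightarrow> T k j = 0\<^sub>m d d"
  shows "det (blocks_mat K K d d T) = 1"
proof -
  let ?B = "blocks_mat K K d d T"
  have "?B $$ (i, l) = 0" if "i < l" "l < K * d" for i l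
  proof -
    have il: "i < K * d" "l < K * d" using that by simp_all
    note b = block_index_less[OF il(1)] block_index_less[OF il(2)]
    have "i div d \<le> l div d" using that by (intro div_le_mono) simp
    then consider "i div d < l div d" | "i div d = l div d" by linarith
    then show ?thesis
    proof cases
      case 1 then show ?thesis using il b assms(2) by (simp add: blocks_mat_index)
    next
      case 2
      then have "i mod d \<noteq> l mod d" using that by (metis div_mult_mod_eq less_irrefl)
      then show ?thesis using il b 2 assms(1) by (simp add: blocks_mat_index)
    qed
  qed
  then have "det ?B = prod_list (diag_mat ?B)"
    by (intro det_lower_triangular[where n = "K * d"]) simp_all
  also have "diag_mat ?B = map (\<lambda>i. 1) [0..<K * d]"
    unfolding diag_mat_def by (simp add: blocks_mat_index block_index_less assms(1))
  also have "prod_list \<dots> = 1" by (simp add: map_replicate_const)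
  finally show ?thesis .
qed

lemma mult_mat_vec_cancel:
  fixes M :: "real mat"
  assumes M: "M \<in> carrier_mat n n" "det M \<noteq> 0"
    and v: "v \<in> carrier_vec n" and w: "w \<in> carrier_vec n" and eq: "M *\<^sub>v v = M *\<^sub>v w"
  shows "v = w"
proof -
  have *: "x = inv_mat M *\<^sub>v (M *\<^sub>v x)" if "x \<in> carrier_vec n" for x
    using inv_mat_props[OF M] that assoc_mult_mat_vec[OF inv_mat_props(1)[OF M] M(1) that] by simp
  show ?thesis using *[OF v] *[OF w] eq by simp
qed

text \<open>With \<open>z = S^-1 T e\<close> one has \<open>T (D (T^T z)) = T e\<close>. Cancelling
  \<open>T\<close> gives \<open>D (T^T z) = e = D w\<close>, cancelling \<open>D\<close> gives
  \<open>T^T z = w\<close>, and \<open>(T e).z = e.(T^T z)\<close>. The witness \<open>w\<close>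
  stands for \<open>D^-1 e\<close>, so that the inverse of a block diagonal matrix need not be
  identified.\<close>

lemma wnorm_sq_inv_factorized:
  assumes T: "T \<in> carrier_mat m m" "det T \<noteq> 0" and D: "D \<in> carrier_mat m m" "det D \<noteq> 0"
    and e: "e \<in> carrier_vec m" and w: "w \<in> carrier_vec m" and Dw: "D *\<^sub>v w = e"
  shows "wnorm_sq (inv_mat (T * D * T\<^sup>T)) (T *\<^sub>v e) = e \<bullet> w"
proof -
  let ?S = "T * D * T\<^sup>T"
  have Tt: "T\<^sup>T \<in> carrier_mat m m" "det T\<^sup>T \<noteq> 0" using T by (simp_all add: det_transpose)
  have S: "?S \<in> carrier_mat m m" using T D by (intro mult_carrier_mat) simp_all
  have "det ?S = det T * det D * det T\<^sup>T"
    using T D by (simp add: det_mult[of _ m])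
  then have dS: "det ?S \<noteq> 0" using T D Tt by simp
  note iS = inv_mat_props[OF S dS]
  have Te: "T *\<^sub>v e \<in> carrier_vec m" using T e by simp
  define z where "z = inv_mat ?S *\<^sub>v (T *\<^sub>v e)"
  have z: "z \<in> carrier_vec m" using iS(1) Te by (simp add: z_def)
  have Tz: "T\<^sup>T *\<^sub>v z \<in> carrier_vec m" using Tt z by simp
  have "T *\<^sub>v (D *\<^sub>v (T\<^sup>T *\<^sub>v z)) = ?S *\<^sub>v z"
    using T(1) D(1) Tt(1) z by (simp only: mat_dim_simps)
  also have "\<dots> = T *\<^sub>v e"
    unfolding z_def using assoc_mult_mat_vec[OF S iS(1) Te] iS(2) Te by simp
  finally have "D *\<^sub>v (T\<^sup>T *\<^sub>v z) = D *\<^sub>v w"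
    unfolding Dw by (rule mult_mat_vec_cancel[OF T mult_mat_vec_carrier[OF D(1) Tz] e])
  then have "T\<^sup>T *\<^sub>v z = w"
    by (rule mult_mat_vec_cancel[OF D Tz w])
  moreover have "(T *\<^sub>v e) \<bullet> z = e \<bullet> (T\<^sup>T *\<^sub>v z)"
    using scalar_prod_mult_transpose[OF Tt(1) e z] by simp
  ultimately show ?thesis by (simp add: wnorm_sq_def z_def)
qed

lemma mat_sum_1:
  assumes "f 0 \<in> carrier_mat r c"
  shows "mat_sum r c f 1 = f 0"
  using assms by (intro mat_sum_single) simp_all

lemma vec_sum_1:
  assumes "f 0 \<in> carrier_vec r"
  shows "vec_sum r f 1 = f 0"
  using assms vec_sum_Suc[of 0 f r] by simp

section \<open>Products with block diagonal matrices\<close>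

lemma blocks_mat_mult_diag:
  assumes f: "\<And>k j. k < K \<Longrightarrow> j < J \<Longrightarrow> f k j \<in> carrier_mat r c"
    and M: "\<And>j. j < J \<Longrightarrow> M j \<in> carrier_mat c s"
  shows "blocks_mat K J r c f * blocks_mat J J c s (\<lambda>j l. if j = l then M j else 0\<^sub>m c s) =
    blocks_mat K J r s (\<lambda>k j. f k j * M j)"
proof -
  have "mat_sum r s (\<lambda>i. f k i * (if i = j then M i else 0\<^sub>m c s)) J = f k j * M j"
    if "k < K" "j < J" for k j
  proof -
    have "mat_sum r s (\<lambda>i. f k i * (if i = j then M i else 0\<^sub>m c s)) J
        = f k j * (if j = j then M j else 0\<^sub>m c s)"
    proof (rule mat_sum_single)
      show "f k i * (if i = j then M i else 0\<^sub>m c s) = 0\<^sub>m r s" if "i < J" "i \<noteq> j" for i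
        using f[OF \<open>k < K\<close> \<open>i < J\<close>] that by simp
      show "f k j * (if j = j then M j else 0\<^sub>m c s) \<in> carrier_mat r s"
        using f M that by (simp add: mult_carrier_mat[of _ r c])
    qed fact
    then show ?thesis by simp
  qed
  then show ?thesis
    using f M by (subst blocks_mat_mult) (auto intro!: blocks_mat_cong)
qed

lemma blocks_mat_mult_kron_transpose:
  assumes f: "\<And>k j. k < K \<Longrightarrow> j < J \<Longrightarrow> f k j \<in> carrier_mat r c" and M: "M \<in> carrier_mat s c"
  shows "blocks_mat K J r c f * (kron (1\<^sub>m J) M)\<^sup>T = blocks_mat K J r s (\<lambda>k j. f k j * M\<^sup>T)"
proof -
  have "(kron (1\<^sub>m J) M)\<^sup>T = blocks_mat J J c s (\<lambda>j l. if j = l then M\<^sup>T else 0\<^sub>m c s)"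
    using M by (subst kron_one[OF M], subst blocks_mat_transpose)
      (auto intro!: blocks_mat_cong)
  then show ?thesis using f M by (simp add: blocks_mat_mult_diag)
qed

lemma kron_mult_blocks_mat:
  assumes f: "\<And>k j. k < K \<Longrightarrow> j < J \<Longrightarrow> f k j \<in> carrier_mat c s" and M: "M \<in> carrier_mat r c"
  shows "kron (1\<^sub>m K) M * blocks_mat K J c s f = blocks_mat K J r s (\<lambda>k j. M * f k j)"
proof -
  have "mat_sum r s (\<lambda>i. (if k = i then M else 0\<^sub>m r c) * f i j) K = M * f k j"
    if "k < K" "j < J" for k j
  proof -
    have "mat_sum r s (\<lambda>i. (if k = i then M else 0\<^sub>m r c) * f i j) K
        = (if k = k then M else 0\<^sub>m r c) * f k j"
    proof (rule mat_sum_single)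
      show "(if k = i then M else 0\<^sub>m r c) * f i j = 0\<^sub>m r s" if "i < K" "i \<noteq> k" for i
        using f[OF \<open>i < K\<close> \<open>j < J\<close>] that by simp
      show "(if k = k then M else 0\<^sub>m r c) * f k j \<in> carrier_mat r s"
        using f M that by (simp add: mult_carrier_mat[of _ r c])
    qed fact
    then show ?thesis by simp
  qed
  then show ?thesis
    unfolding kron_one[OF M] using f M by (subst blocks_mat_mult) (auto intro!: blocks_mat_cong)
qed

lemma blocks_diag_mult_vec:
  assumes x: "\<And>k. k < K \<Longrightarrow> x k \<in> carrier_vec c" and M: "\<And>k. k < K \<Longrightarrow> M k \<in> carrier_mat r c"
  shows "blocks_mat K K r c (\<lambda>k j. if k = j then M k else 0\<^sub>m r c) *\<^sub>v col_stack K c x =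
    col_stack K r (\<lambda>k. M k *\<^sub>v x k)"
proof -
  have "vec_sum r (\<lambda>j. (if k = j then M k else 0\<^sub>m r c) *\<^sub>v x j) K = M k *\<^sub>v x k" if k: "k < K" for k
  proof -
    let ?f = "\<lambda>j. (if k = j then M k else 0\<^sub>m r c) *\<^sub>v x j"
    have z: "?f j = 0\<^sub>v r" if "j < K" "j \<noteq> k" for j
      using x that by (intro eq_vecI) auto
    have c: "?f j \<in> carrier_vec r" if "j < K" for j
      using x[OF that] M[OF k] by (cases "k = j") (simp_all add: mult_mat_vec_carrier[of _ r c])
    have "vec_sum r ?f K = vec_sum r ?f (Suc k)"
      using k by (intro vec_sum_truncate z c) auto
    also have "\<dots> = ?f k + vec_sum r ?f k"
      using k c by (intro vec_sum_Suc) auto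
    also have "vec_sum r ?f k = vec_sum r ?f 0"
      using k by (intro vec_sum_truncate z c) auto
    finally show ?thesis using c[OF k] by simp
  qed
  then show ?thesis
    using x M by (subst blocks_mat_mult_vec) (auto intro!: col_stack_cong)
qed

lemma kron_mult_col_stack:
  assumes "\<And>k. k < K \<Longrightarrow> x k \<in> carrier_vec c" and M: "M \<in> carrier_mat r c"
  shows "kron (1\<^sub>m K) M *\<^sub>v col_stack K c x = col_stack K r (\<lambda>k. M *\<^sub>v x k)"
  unfolding kron_one[OF M] using assms by (rule blocks_diag_mult_vec)

section \<open>Products of Gaussian densities\<close>

text \<open>The right-hand side imitates the density of a stacked vector of dimension
  \<open>card I * d\<close>, with determinant and exponent already split over the blocks.\<close>

lemma prod_gauss_density:
  assumes x: "\<And>k. k \<in> I \<Longrightarrow> dim_vec (x k) = d"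
  shows "(\<Prod>k\<in>I. gauss_density (x k) (m k) (S k)) =
    (2 * pi) powr (- real (card I * d) / 2) * (\<Prod>k\<in>I. det (S k)) powr (- 1 / 2) *
    exp (- 1 / 2 * (\<Sum>k\<in>I. wnorm_sq (inv_mat (S k)) (x k - m k)))"
proof -
  have "(\<Prod>k\<in>I. (2 * pi) powr (- real (dim_vec (x k)) / 2)) = (2 * pi) powr (\<Sum>k\<in>I. - real d / 2)"
    using x by (subst powr_sum) simp_all
  also have "(\<Sum>k\<in>I. - real d / 2) = - real (card I * d) / 2" by simp
  finally show ?thesis
    \<comment> \<open>For infinite \<open>I\<close> the products are 1 and the sum and
      \<open>card I\<close> are 0, so both sides equal 1.\<close>
    by (cases "finite I") (simp_all add: gauss_density_def prod.distrib prod_powr_distrib exp_sum sum_distrib_left)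
qed

section \<open>The factorization of the stacked system\<close>

declare pred_cov.simps [simp del] innov_cov.simps [simp del] gain.simps [simp del]
  filt_cov.simps [simp del] pred_mean.simps [simp del] filt_mean.simps [simp del]
  trans_mat.simps [simp del]

section \<open>The Riccati recursion and the transition matrices\<close>

text \<open>Covariances, gains and \<open>T\<close> depend on \<theta> and the inputs alone; the
  observations and the horizon therefore stay variable.\<close>

locale quasi_linear_system =
  fixes Q :: "'u qlsys" and \<theta> :: "real vec" and u :: "nat \<Rightarrow> 'u"
  assumes sys: "wf_qlsys Q" and theta: "\<theta> \<in> Theta Q"
begin

abbreviation "n \<equiv> dim_x Q"
abbreviation "d \<equiv> dim_y Q"
abbreviation "A k \<equiv> Amat Q \<theta> (u k)"
abbreviation "B k \<equiv> Bvec Q \<theta> (u k)"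
abbreviation "G k \<equiv> Gmat Q \<theta> (u k)"
abbreviation "C \<equiv> Cmat Q"
abbreviation "P \<equiv> pred_cov Q \<theta> u"
abbreviation "\<Sigma> \<equiv> innov_cov Q \<theta> u"
abbreviation "L \<equiv> gain Q \<theta> u"
abbreviation "\<Phi> \<equiv> trans_mat Q \<theta> u"

lemma Amat_carrier [simp]: "A k \<in> carrier_mat n n"
  and Bvec_carrier [simp]: "B k \<in> carrier_vec n"
  and Gmat_carrier [simp]: "G k \<in> carrier_mat n (dim_w Q)"
  and Cmat_carrier [simp]: "C \<in> carrier_mat d n"
  and Sv_carrier [simp]: "Sv Q \<in> carrier_mat d d"
  and m0_carrier [simp]: "m0 Q \<theta> \<in> carrier_vec n"
  and S0_carrier [simp]: "S0 Q \<theta> \<in> carrier_mat n n"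
  using sys theta by (auto simp: wf_qlsys_def pos_def_def)

lemma pos_def_Sv: "pos_def d (Sv Q)" and pos_def_S0: "pos_def n (S0 Q \<theta>)"
  using sys theta by (auto simp: wf_qlsys_def)

text \<open>Semidefiniteness at time \<open>k\<close> is a premise so that these facts are available
  inside the induction that proves it for all times.\<close>

lemma innovation_of_pos_semidef:
  assumes "pos_semidef n (P k)"
  shows "\<Sigma> k \<in> carrier_mat d d" "det (\<Sigma> k) \<noteq> 0" "L k \<in> carrier_mat n d"
    "L k * \<Sigma> k = P k * C\<^sup>T"
proof -
  have P: "P k \<in> carrier_mat n n" using assms by (simp add: pos_semidef_def)
  show S: "\<Sigma> k \<in> carrier_mat d d"
    using P by (simp add: innov_cov.simps mult_carrier_mat[of _ _ n])
  show det: "det (\<Sigma> k) \<noteq> 0"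
    unfolding innov_cov.simps
    by (rule pos_def_add_pos_semidef[OF pos_def_Sv pos_semidef_congruence[OF assms Cmat_carrier]])
  note i = inv_mat_props[OF S det]
  have PC: "P k * C\<^sup>T \<in> carrier_mat n d" using P by (simp add: mult_carrier_mat[of _ _ n])
  show "L k \<in> carrier_mat n d"
    unfolding gain.simps using PC i(1) by (rule mult_carrier_mat)
  show "L k * \<Sigma> k = P k * C\<^sup>T"
    unfolding gain.simps assoc_mult_mat[OF PC i(1) S] i(3) by (rule right_mult_one_mat[OF PC])
qed

lemma pos_semidef_pred_cov: "pos_semidef n (P k)"
proof (induction k)
  case 0
  show ?case
    unfolding pred_cov.simps using pos_def_S0 by (rule pos_def_imp_pos_semidef)
next
  case (Suc k)
  note i = innovation_of_pos_semidef[OF Suc]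
  have "pos_semidef n (filt_cov Q \<theta> u k)"
    unfolding filt_cov.simps
    by (rule pos_semidef_measurement_update[OF Suc pos_def_Sv Cmat_carrier innov_cov.simps i(3,4)])
  then show ?case
    unfolding pred_cov.simps
    by (intro pos_semidef_add pos_semidef_congruence[OF _ Amat_carrier] pos_semidef_gram[OF Gmat_carrier])
qed

lemmas innov_cov_carrier [simp] = innovation_of_pos_semidef(1)[OF pos_semidef_pred_cov]
  and innov_cov_det = innovation_of_pos_semidef(2)[OF pos_semidef_pred_cov]
  and gain_carrier [simp] = innovation_of_pos_semidef(3)[OF pos_semidef_pred_cov]
  and gain_innov_cov = innovation_of_pos_semidef(4)[OF pos_semidef_pred_cov]

lemma pred_cov_carrier [simp]: "P k \<in> carrier_mat n n" and pred_cov_sym: "(P k)\<^sup>T = P k"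
  using pos_semidef_pred_cov by (simp_all add: pos_semidef_def)

lemma innov_cov_sym: "(\<Sigma> k)\<^sup>T = \<Sigma> k"
proof -
  have "(Sv Q)\<^sup>T = Sv Q" using pos_def_Sv by (simp add: pos_def_def)
  moreover note Cmat_carrier Sv_carrier pred_cov_carrier[of k] pred_cov_sym[of k]
  ultimately show ?thesis
    by (simp only: innov_cov.simps mat_dim_simps)
qed

text \<open>Transposed form of \<open>gain_innov_cov\<close>; it serves the blocks above the
  diagonal, where the gain stands in the transposed factor.\<close>

lemma innov_cov_gain: "\<Sigma> k * (L k)\<^sup>T = C * P k"
  using arg_cong[OF gain_innov_cov, of transpose_mat k] transpose_mult[OF gain_carrier innov_cov_carrier, of k k]
    transpose_mult[OF pred_cov_carrier, of "C\<^sup>T" d k]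
  by (simp add: innov_cov_sym pred_cov_sym)

lemma trans_carrier [simp]: "\<Phi> k j \<in> carrier_mat n n"
  by (induction k) (simp_all add: trans_mat.simps mult_carrier_mat[of _ _ n])

text \<open>For \<open>k > 0\<close> this is the else branch of \<open>trans_mat\<close>, whose
  default value is the identity.\<close>

lemma trans_self: "\<Phi> k k = 1\<^sub>m n"
  by (cases k) (simp_all add: trans_mat.simps)

lemma trans_Suc: "j \<le> k \<Longrightarrow> \<Phi> (Suc k) j = A k * \<Phi> k j"
  by (simp add: trans_mat.simps)

text \<open>The definition peels off the newest factor; telescoping in time needs the oldest
  one.\<close>

lemma trans_Suc_right:
  assumes "j < k"
  shows "\<Phi> k j = \<Phi> k (Suc j) * A j"
  using assms
proof (induction k)
  case (Suc k)
  show ?case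
  proof (cases "j = k")
    case True
    then show ?thesis
      by (simp add: trans_Suc trans_self left_mult_one_mat[OF Amat_carrier] right_mult_one_mat[OF Amat_carrier])
  next
    case False
    with Suc show ?thesis
      using assoc_mult_mat[OF Amat_carrier trans_carrier Amat_carrier, of k k "Suc j" j] by (simp add: trans_Suc)
  qed
qed simp

section \<open>The covariance factorization\<close>

text \<open>The covariance removed by the measurement at time \<open>k\<close>: the filtered
  covariance is \<open>P k - X k\<close>.\<close>

abbreviation "X k \<equiv> L k * \<Sigma> k * (L k)\<^sup>T"

lemma X_carrier: "X k \<in> carrier_mat n n"
  by (intro mult_carrier_mat[of _ n d] mult_carrier_mat[of _ d d]) simp_all

text \<open>Telescoping the prediction step \<open>P (Suc m) = A m (P m - X m) (A m)\<^sup>T + G m (G m)\<^sup>T\<close> trades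
  the process noise accumulated before time \<open>m\<close> for the information gained before time \<open>m\<close>.\<close>
lemma state_cov_telescope:
  assumes "m \<le> k" "m \<le> l"
  shows "\<Phi> k 0 * S0 Q \<theta> * (\<Phi> l 0)\<^sup>T +
      mat_sum n n (\<lambda>j. \<Phi> k (j + 1) * G j * (\<Phi> l (j + 1) * G j)\<^sup>T) m =
    \<Phi> k m * P m * (\<Phi> l m)\<^sup>T + mat_sum n n (\<lambda>j. \<Phi> k j * X j * (\<Phi> l j)\<^sup>T) m"
  using assms
proof (induction m)
  case 0
  show ?case by (simp add: mat_sum_0 pred_cov.simps)
next
  case (Suc m)
  define V where "V = \<Phi> k 0 * S0 Q \<theta> * (\<Phi> l 0)\<^sup>T"
  define g where "g = \<Phi> k (m + 1) * G m * (\<Phi> l (m + 1) * G m)\<^sup>T"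
  define p where "p = \<Phi> k m * P m * (\<Phi> l m)\<^sup>T"
  define x where "x = \<Phi> k m * X m * (\<Phi> l m)\<^sup>T"
  have c: "V \<in> carrier_mat n n" "g \<in> carrier_mat n n" "p \<in> carrier_mat n n" "x \<in> carrier_mat n n"
    unfolding V_def g_def p_def x_def using X_carrier
    by (simp_all add: mult_carrier_mat[of _ n n] mult_carrier_mat[of _ n "dim_w Q"])
  \<comment> \<open>The outer factors of the prediction step are absorbed by
    \<open>\<Phi> k (Suc m) * A m = \<Phi> k m\<close> and likewise for \<open>l\<close>, which uses
    \<open>m < k\<close> and \<open>m < l\<close>.\<close>
  have "\<Phi> k (Suc m) * P (Suc m) * (\<Phi> l (Suc m))\<^sup>T = p - x + g"
    using Suc.prems Amat_carrier[of m] Gmat_carrier[of m] X_carrier[of m] pred_cov_carrier[of m]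
      trans_carrier[of k "Suc m"] trans_carrier[of l "Suc m"] gain_carrier[of m] innov_cov_carrier[of m]
    by (simp only: p_def x_def g_def pred_cov.simps filt_cov.simps trans_Suc_right Suc_le_eq
        Suc_eq_plus1[symmetric] mat_dim_simps)
  moreover have "mat_sum n n (\<lambda>j. \<Phi> k j * X j * (\<Phi> l j)\<^sup>T) (Suc m) =
      mat_sum n n (\<lambda>j. \<Phi> k j * X j * (\<Phi> l j)\<^sup>T) m + x"
    unfolding x_def by (rule mat_sum_Suc) (use c in \<open>simp add: x_def\<close>)
  moreover have "mat_sum n n (\<lambda>j. \<Phi> k (j + 1) * G j * (\<Phi> l (j + 1) * G j)\<^sup>T) (Suc m) =
      mat_sum n n (\<lambda>j. \<Phi> k (j + 1) * G j * (\<Phi> l (j + 1) * G j)\<^sup>T) m + g"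
    unfolding g_def by (rule mat_sum_Suc) (use c in \<open>simp add: g_def\<close>)
  moreover have "V + (M + g) = (p - x + g) + (N + x)"
    if "V + M = p + N" "M \<in> carrier_mat n n" "N \<in> carrier_mat n n" for M N
  proof (rule eq_matI)
    fix a b assume "a < dim_row ((p - x + g) + (N + x))" "b < dim_col ((p - x + g) + (N + x))"
    then have ab: "a < n" "b < n" using c by simp_all
    have "(V + M) $$ (a, b) = (p + N) $$ (a, b)" using that by simp
    then show "(V + (M + g)) $$ (a, b) = ((p - x + g) + (N + x)) $$ (a, b)"
      using ab c that(2,3) by simp
  qed (use c in simp_all)
  ultimately show ?case
    using Suc by (simp add: V_def[symmetric] p_def[symmetric])
qed

text \<open>The lower blocks are written with \<open>A j * L j\<close> to match the correction terms
  of the predicted mean; the covariance side uses the shorter form \<open>T_eq\<close>.\<close>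

definition T :: "nat \<Rightarrow> nat \<Rightarrow> real mat" where
  "T k j = (if j = k then 1\<^sub>m d else if j < k then C * (\<Phi> k (j + 1) * (A j * L j)) else 0\<^sub>m d d)"

lemma T_carrier [simp]: "T k j \<in> carrier_mat d d"
  unfolding T_def by (simp add: mult_carrier_mat[of _ d n] mult_carrier_mat[of _ n n])

lemma T_eq:
  assumes "j < k"
  shows "T k j = C * (\<Phi> k j * L j)"
  using assms assoc_mult_mat[OF trans_carrier Amat_carrier gain_carrier, of k "Suc j" j j]
  by (simp add: T_def trans_Suc_right)

text \<open>Terms with \<open>j < min k l\<close> give the \<open>X\<close> sum of
  \<open>state_cov_telescope\<close>, and the term \<open>j = min k l\<close> gives its
  \<open>P\<close> part, together with \<open>Sv Q\<close> on the diagonal. The telescoped side is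
  the prior plus process noise.\<close>

lemma T_factorization_block:
  assumes k: "k < K" and l: "l < K"
  shows "mat_sum d d (\<lambda>j. T k j * \<Sigma> j * (T l j)\<^sup>T) K =
    C * (\<Phi> k 0 * S0 Q \<theta> * (\<Phi> l 0)\<^sup>T +
      mat_sum n n (\<lambda>j. \<Phi> k (j + 1) * G j * (\<Phi> l (j + 1) * G j)\<^sup>T) (min k l)) * C\<^sup>T +
    (if k = l then Sv Q else 0\<^sub>m d d)"
proof -
  define m where "m = min k l"
  define W where "W = mat_sum n n (\<lambda>j. \<Phi> k j * X j * (\<Phi> l j)\<^sup>T) m"
  have W: "W \<in> carrier_mat n n" by (simp add: W_def)
  let ?t = "\<lambda>j. T k j * \<Sigma> j * (T l j)\<^sup>T"
  have t: "?t j \<in> carrier_mat d d" for j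
    by (simp add: mult_carrier_mat[of _ d d])
  \<comment> \<open>The cut is at \<open>Suc m\<close> because \<open>T\<close> has identity blocks
    on its diagonal, so the term \<open>j = m\<close> survives; the process noise sum stops one
    earlier since its factor is strictly lower triangular.\<close>
  have "mat_sum d d ?t K = mat_sum d d ?t (Suc m)"
  proof (rule mat_sum_truncate)
    fix j assume "Suc m \<le> j"
    then have "k < j \<or> l < j" by (auto simp: m_def)
    then have "T k j = 0\<^sub>m d d \<or> T l j = 0\<^sub>m d d" by (auto simp: T_def)
    then show "?t j = 0\<^sub>m d d"
      by (auto simp: left_mult_zero_mat[OF innov_cov_carrier]
          left_mult_zero_mat[OF iffD2[OF transpose_carrier_mat T_carrier]]
          right_mult_zero_mat[OF mult_carrier_mat[OF T_carrier innov_cov_carrier]])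
  qed (use k l in \<open>simp add: m_def\<close>)
  also have "\<dots> = mat_sum d d ?t m + ?t m"
    using t by (rule mat_sum_Suc)
  also have "mat_sum d d ?t m = C * W * C\<^sup>T"
  proof -
    have "?t j = C * (\<Phi> k j * X j * (\<Phi> l j)\<^sup>T) * C\<^sup>T" if "j < m" for j
    proof -
      have "j < k" "j < l" using that by (simp_all add: m_def)
      then show ?thesis
        using Cmat_carrier trans_carrier[of k j] trans_carrier[of l j] gain_carrier[of j] innov_cov_carrier[of j]
        by (simp only: T_eq mat_dim_simps)
    qed
    then have "mat_sum d d ?t m = mat_sum d d (\<lambda>j. C * (\<Phi> k j * X j * (\<Phi> l j)\<^sup>T) * C\<^sup>T) m"
      by (rule mat_sum_cong)
    also have "\<dots> = mat_sum d n (\<lambda>j. C * (\<Phi> k j * X j * (\<Phi> l j)\<^sup>T)) m * C\<^sup>T"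
      using X_carrier by (intro mat_sum_mult[symmetric]) (simp_all add: mult_carrier_mat[of _ _ n])
    also have "mat_sum d n (\<lambda>j. C * (\<Phi> k j * X j * (\<Phi> l j)\<^sup>T)) m = C * W"
      unfolding W_def
      using X_carrier by (intro mult_mat_sum[symmetric]) (simp_all add: mult_carrier_mat[of _ _ n])
    finally show ?thesis .
  qed
  \<comment> \<open>At \<open>j = m\<close> at least one of the two \<open>T\<close> blocks is the
    identity. Off the diagonal the remaining gain is absorbed by \<open>L \<Sigma> = P C^T\<close>
    or \<open>\<Sigma> L^T = C P\<close>; on the diagonal \<open>\<Sigma>\<close> itself remains and
    contributes \<open>Sv Q\<close>.\<close>
  also have "?t m = C * (\<Phi> k m * P m * (\<Phi> l m)\<^sup>T) * C\<^sup>T + (if k = l then Sv Q else 0\<^sub>m d d)"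
  proof -
    note c = Cmat_carrier trans_carrier[of k m] trans_carrier[of l m] gain_carrier[of m] innov_cov_carrier[of m]
      pred_cov_carrier[of m]
    consider "m = k" "k = l" | "m = l" "l < k" | "m = k" "k < l" unfolding m_def by linarith
    then show ?thesis
    proof cases
      case 1
      have "C * (P k) * C\<^sup>T \<in> carrier_mat d d"
        by (simp add: mult_carrier_mat[of _ d n])
      then have "\<Sigma> k = C * P k * C\<^sup>T + Sv Q"
        unfolding innov_cov.simps by (rule comm_add_mat[OF Sv_carrier])
      moreover have "?t k = \<Sigma> k"
        using 1 by (simp add: T_def left_mult_one_mat[OF innov_cov_carrier] right_mult_one_mat[OF innov_cov_carrier])
      moreover have "\<Phi> k k * P k * (\<Phi> k k)\<^sup>T = P k"
        by (simp add: trans_self left_mult_one_mat[OF pred_cov_carrier] right_mult_one_mat[OF pred_cov_carrier])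
      ultimately show ?thesis using 1 by simp
    next
      case 2
      have "?t m = T k m * \<Sigma> m"
        using 2 by (simp add: T_def[of l l] right_mult_one_mat[of _ d d] mult_carrier_mat[of _ d d])
      also have "\<dots> = C * (\<Phi> k m * (L m * \<Sigma> m))"
        using 2 c by (simp only: T_eq mat_dim_simps)
      also have "\<dots> = C * (\<Phi> k m * P m) * C\<^sup>T"
        unfolding gain_innov_cov using c by (simp only: mat_dim_simps)
      also have "\<Phi> k m * P m = \<Phi> k m * P m * (\<Phi> l m)\<^sup>T"
        using 2 by (simp add: trans_self right_mult_one_mat[OF mult_carrier_mat[OF trans_carrier pred_cov_carrier]])
      finally show ?thesis using 2 by (simp add: mult_carrier_mat[of _ d n] mult_carrier_mat[of _ n n])
    next
      case 3
      have "?t m = \<Sigma> m * (C * (\<Phi> l m * L m))\<^sup>T"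
        using 3 by (simp add: T_eq T_def[of k k] left_mult_one_mat[OF innov_cov_carrier])
      also have "\<dots> = \<Sigma> m * (L m)\<^sup>T * (\<Phi> l m)\<^sup>T * C\<^sup>T"
        using c by (simp only: mat_dim_simps)
      also have "\<dots> = C * (P m * (\<Phi> l m)\<^sup>T) * C\<^sup>T"
        unfolding innov_cov_gain using c by (simp only: mat_dim_simps)
      also have "P m * (\<Phi> l m)\<^sup>T = \<Phi> k m * P m * (\<Phi> l m)\<^sup>T"
        using 3 by (simp add: trans_self left_mult_one_mat[OF pred_cov_carrier])
      finally show ?thesis using 3 by (simp add: mult_carrier_mat[of _ d n] mult_carrier_mat[of _ n n])
    qed
  qed
  also have "C * W * C\<^sup>T + (C * (\<Phi> k m * P m * (\<Phi> l m)\<^sup>T) * C\<^sup>T + (if k = l then Sv Q else 0\<^sub>m d d))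
      = C * (\<Phi> k m * P m * (\<Phi> l m)\<^sup>T + W) * C\<^sup>T + (if k = l then Sv Q else 0\<^sub>m d d)"
  proof -
    define p where "p = \<Phi> k m * P m * (\<Phi> l m)\<^sup>T"
    have p: "p \<in> carrier_mat n n" by (simp add: p_def mult_carrier_mat[of _ n n])
    have "C * (p + W) * C\<^sup>T = C * p * C\<^sup>T + C * W * C\<^sup>T"
      using p W Cmat_carrier by (simp only: mat_dim_simps)
    also have "\<dots> = C * W * C\<^sup>T + C * p * C\<^sup>T"
      using p W by (intro comm_add_mat[of _ d d]) (simp_all add: mult_carrier_mat[of _ _ n])
    finally show ?thesis unfolding p_def[symmetric]
      using p W by (simp add: assoc_add_mat[of _ d d] mult_carrier_mat[of _ _ n])
  qed
  also have "\<Phi> k m * P m * (\<Phi> l m)\<^sup>T + W = \<Phi> k 0 * S0 Q \<theta> * (\<Phi> l 0)\<^sup>T +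
      mat_sum n n (\<lambda>j. \<Phi> k (j + 1) * G j * (\<Phi> l (j + 1) * G j)\<^sup>T) m"
    unfolding W_def by (rule state_cov_telescope[symmetric]) (simp_all add: m_def)
  finally show ?thesis by (simp add: m_def)
qed

lemma stacked_C_carrier: "stacked_C Q N \<in> carrier_mat ((N + 1) * d) ((N + 1) * n)"
  unfolding stacked_C_def kron_one[OF Cmat_carrier] by (rule blocks_mat_carrier)

text \<open>Block (k, l) is the covariance of \<open>y_k\<close> and \<open>y_l\<close>: only noise
  terms with \<open>j < min k l\<close> have reached both states, and the measurement noise
  correlates only for \<open>k = l\<close>.\<close>

lemma S_cov_blocks:
  "S_cov Q N \<theta> u = blocks_mat (N + 1) (N + 1) d d (\<lambda>k l. C * (\<Phi> k 0 * S0 Q \<theta> * (\<Phi> l 0)\<^sup>T +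
      mat_sum n n (\<lambda>j. \<Phi> k (j + 1) * G j * (\<Phi> l (j + 1) * G j)\<^sup>T) (min k l)) * C\<^sup>T +
    (if k = l then Sv Q else 0\<^sub>m d d))"
proof -
  let ?K = "N + 1"
  let ?g = "\<lambda>k j. if j < k then \<Phi> k (j + 1) * G j else 0\<^sub>m n (dim_w Q)"
  let ?s = "\<lambda>k l. mat_sum n n (\<lambda>j. \<Phi> k (j + 1) * G j * (\<Phi> l (j + 1) * G j)\<^sup>T) (min k l)"
  have PhiG: "\<Phi> k j * G i \<in> carrier_mat n (dim_w Q)" for k j i
    by (simp add: mult_carrier_mat[of _ n n])
  have PhiS: "\<Phi> k j * S0 Q \<theta> \<in> carrier_mat n n" for k j
    by (simp add: mult_carrier_mat[of _ n n])
  have PSP: "\<Phi> k j * S0 Q \<theta> * (\<Phi> l j)\<^sup>T \<in> carrier_mat n n" for k l j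
    using PhiS by (simp add: mult_carrier_mat[of _ n n])
  have At: "(stacked_A Q N \<theta> u)\<^sup>T = blocks_mat 1 ?K n n (\<lambda>_ k. (\<Phi> k 0)\<^sup>T)"
    unfolding stacked_A_def by (rule blocks_mat_transpose) simp
  \<comment> \<open>The prior covariance is read as a 1 by 1 block matrix, so that the block product
    rule applies.\<close>
  have "stacked_A Q N \<theta> u * S0 Q \<theta> =
      blocks_mat ?K 1 n n (\<lambda>k _. \<Phi> k 0) * blocks_mat 1 1 n n (\<lambda>_ _. S0 Q \<theta>)"
    by (simp only: stacked_A_def blocks_mat_single[OF S0_carrier])
  also have "\<dots> = blocks_mat ?K 1 n n (\<lambda>k _. mat_sum n n (\<lambda>j. \<Phi> k 0 * S0 Q \<theta>) 1)"
    by (rule blocks_mat_mult) simp_all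
  also have "\<dots> = blocks_mat ?K 1 n n (\<lambda>k _. \<Phi> k 0 * S0 Q \<theta>)"
    by (intro blocks_mat_cong mat_sum_1 PhiS)
  finally have AS: "stacked_A Q N \<theta> u * S0 Q \<theta> = blocks_mat ?K 1 n n (\<lambda>k _. \<Phi> k 0 * S0 Q \<theta>)" .
  have "stacked_A Q N \<theta> u * S0 Q \<theta> * (stacked_A Q N \<theta> u)\<^sup>T =
      blocks_mat ?K ?K n n (\<lambda>k l. mat_sum n n (\<lambda>j. \<Phi> k 0 * S0 Q \<theta> * (\<Phi> l 0)\<^sup>T) 1)"
    unfolding AS At using PhiS by (intro blocks_mat_mult) simp_all
  also have "\<dots> = blocks_mat ?K ?K n n (\<lambda>k l. \<Phi> k 0 * S0 Q \<theta> * (\<Phi> l 0)\<^sup>T)"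
    by (intro blocks_mat_cong mat_sum_1 PSP)
  finally have ASA: "stacked_A Q N \<theta> u * S0 Q \<theta> * (stacked_A Q N \<theta> u)\<^sup>T =
      blocks_mat ?K ?K n n (\<lambda>k l. \<Phi> k 0 * S0 Q \<theta> * (\<Phi> l 0)\<^sup>T)" .
  have gc: "?g k j \<in> carrier_mat n (dim_w Q)" for k j
    using PhiG by simp
  have "stacked_G Q N \<theta> u * (stacked_G Q N \<theta> u)\<^sup>T =
      blocks_mat ?K N n (dim_w Q) ?g * blocks_mat N ?K (dim_w Q) n (\<lambda>j l. (?g l j)\<^sup>T)"
    unfolding stacked_G_def by (subst blocks_mat_transpose) (use gc in simp_all)
  also have "\<dots> = blocks_mat ?K ?K n n (\<lambda>k l. mat_sum n n (\<lambda>j. ?g k j * (?g l j)\<^sup>T) N)"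
    using gc by (intro blocks_mat_mult) simp_all
  also have "\<dots> = blocks_mat ?K ?K n n ?s"
  proof (rule blocks_mat_cong)
    fix k l assume "k < ?K" "l < ?K"
    \<comment> \<open>\<open>k, l < N + 1\<close> gives \<open>min k l \<le> N\<close>, so the cut
      stays within the \<open>N\<close> noise blocks.\<close>
    then have "mat_sum n n (\<lambda>j. ?g k j * (?g l j)\<^sup>T) N = mat_sum n n (\<lambda>j. ?g k j * (?g l j)\<^sup>T) (min k l)"
    proof (intro mat_sum_truncate)
      fix j assume "min k l \<le> j"
      then have "k \<le> j \<or> l \<le> j" by auto
      then have "?g k j = 0\<^sub>m n (dim_w Q) \<or> ?g l j = 0\<^sub>m n (dim_w Q)" by auto
      then show "?g k j * (?g l j)\<^sup>T = 0\<^sub>m n n"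
      proof
        assume z: "?g k j = 0\<^sub>m n (dim_w Q)"
        show ?thesis unfolding z by (rule left_mult_zero_mat) (use gc in simp)
      next
        assume z: "?g l j = 0\<^sub>m n (dim_w Q)"
        show ?thesis unfolding z using right_mult_zero_mat[OF gc] by simp
      qed
    qed simp
    also have "\<dots> = ?s k l" by (rule mat_sum_cong) simp
    finally show "mat_sum n n (\<lambda>j. ?g k j * (?g l j)\<^sup>T) N = ?s k l" .
  qed
  finally have GG: "stacked_G Q N \<theta> u * (stacked_G Q N \<theta> u)\<^sup>T = blocks_mat ?K ?K n n ?s" .
  let ?x = "\<lambda>k l. \<Phi> k 0 * S0 Q \<theta> * (\<Phi> l 0)\<^sup>T + ?s k l"
  have Cx: "C * ?x k l \<in> carrier_mat d n" for k l
    by (rule mult_carrier_mat[OF Cmat_carrier]) simp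
  have "S_cov Q N \<theta> u = stacked_C Q N * blocks_mat ?K ?K n n ?x * (stacked_C Q N)\<^sup>T + kron (1\<^sub>m ?K) (Sv Q)"
    unfolding S_cov_def ASA GG by (subst blocks_mat_add) simp_all
  also have "stacked_C Q N * blocks_mat ?K ?K n n ?x = blocks_mat ?K ?K d n (\<lambda>k l. C * ?x k l)"
    unfolding stacked_C_def by (rule kron_mult_blocks_mat) simp_all
  also have "\<dots> * (stacked_C Q N)\<^sup>T = blocks_mat ?K ?K d d (\<lambda>k l. C * ?x k l * C\<^sup>T)"
    unfolding stacked_C_def by (rule blocks_mat_mult_kron_transpose) (use Cx in simp_all)
  also have "kron (1\<^sub>m ?K) (Sv Q) = blocks_mat ?K ?K d d (\<lambda>k l. if k = l then Sv Q else 0\<^sub>m d d)"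
    by (rule kron_one) simp
  also have "blocks_mat ?K ?K d d (\<lambda>k l. C * ?x k l * C\<^sup>T) + \<dots> =
      blocks_mat ?K ?K d d (\<lambda>k l. C * ?x k l * C\<^sup>T + (if k = l then Sv Q else 0\<^sub>m d d))"
    by (rule blocks_mat_add) simp
  finally show ?thesis .
qed

abbreviation "T_mat N \<equiv> blocks_mat (N + 1) (N + 1) d d T"
abbreviation "D_mat N \<equiv> blocks_mat (N + 1) (N + 1) d d (\<lambda>k j. if k = j then \<Sigma> k else 0\<^sub>m d d)"

lemma S_cov_factorization: "S_cov Q N \<theta> u = T_mat N * D_mat N * (T_mat N)\<^sup>T"
proof -
  let ?K = "N + 1"
  have TS: "T k j * \<Sigma> j \<in> carrier_mat d d" for k j
    by (simp add: mult_carrier_mat[of _ d d])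
  have "T_mat N * D_mat N = blocks_mat ?K ?K d d (\<lambda>k j. T k j * \<Sigma> j)"
    by (rule blocks_mat_mult_diag) simp_all
  moreover have "(T_mat N)\<^sup>T = blocks_mat ?K ?K d d (\<lambda>j l. (T l j)\<^sup>T)"
    by (rule blocks_mat_transpose) simp
  moreover have "blocks_mat ?K ?K d d (\<lambda>k j. T k j * \<Sigma> j) * blocks_mat ?K ?K d d (\<lambda>j l. (T l j)\<^sup>T)
      = blocks_mat ?K ?K d d (\<lambda>k l. mat_sum d d (\<lambda>j. T k j * \<Sigma> j * (T l j)\<^sup>T) ?K)"
    using TS by (intro blocks_mat_mult) simp_all
  ultimately show ?thesis
    unfolding S_cov_blocks by (simp only:) (rule blocks_mat_cong, rule T_factorization_block[symmetric])
qed

lemma det_T_mat: "det (T_mat N) = 1"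
  by (rule det_blocks_mat_unit_lower) (simp_all add: T_def)

lemma det_D_mat: "det (D_mat N) = (\<Prod>k = 0..N. det (\<Sigma> k))"
  by (subst det_blocks_mat_diag) (simp_all add: lessThan_Suc_atMost atLeast0AtMost)

lemma det_S_cov: "det (S_cov Q N \<theta> u) = (\<Prod>k = 0..N. det (\<Sigma> k))"
proof -
  have TD: "T_mat N * D_mat N \<in> carrier_mat ((N + 1) * d) ((N + 1) * d)"
    by (rule mult_carrier_mat) (rule blocks_mat_carrier)+
  have "(T_mat N)\<^sup>T \<in> carrier_mat ((N + 1) * d) ((N + 1) * d)"
    by (subst transpose_carrier_mat) (rule blocks_mat_carrier)
  then show ?thesis
    unfolding S_cov_factorization
    by (simp only: det_mult[OF TD] det_mult[OF blocks_mat_carrier blocks_mat_carrier]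
        det_transpose[OF blocks_mat_carrier] det_T_mat det_D_mat mult_1 mult_1_right)
qed

section \<open>Predicted means and innovations\<close>

text \<open>The state at time \<open>k\<close> of the linear system started at 0 and driven by the
  additive inputs \<open>b\<close>. It is used for the drift and for the measurement corrections
  alike.\<close>

definition response :: "(nat \<Rightarrow> real vec) \<Rightarrow> nat \<Rightarrow> real vec" where
  "response b k = vec_sum n (\<lambda>j. \<Phi> k (j + 1) *\<^sub>v b j) k"

lemma response_carrier:
  assumes "\<And>j. b j \<in> carrier_vec n"
  shows "response b k \<in> carrier_vec n"
  unfolding response_def using assms by (intro vec_sum_carrier mult_mat_vec_carrier[of _ n n]) simp_all

lemma response_Suc:
  assumes b: "\<And>j. b j \<in> carrier_vec n"
  shows "response b (Suc k) = A k *\<^sub>v response b k + b k"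
proof -
  have c: "\<Phi> i j *\<^sub>v b l \<in> carrier_vec n" for i j l
    using b by (intro mult_mat_vec_carrier[of _ n n]) simp_all
  have "response b (Suc k) = \<Phi> (Suc k) (k + 1) *\<^sub>v b k + vec_sum n (\<lambda>j. \<Phi> (Suc k) (j + 1) *\<^sub>v b j) k"
    unfolding response_def by (rule vec_sum_Suc) (rule c)
  also have "\<Phi> (Suc k) (k + 1) *\<^sub>v b k = b k" using b by (simp add: trans_self)
  also have "vec_sum n (\<lambda>j. \<Phi> (Suc k) (j + 1) *\<^sub>v b j) k = vec_sum n (\<lambda>j. A k *\<^sub>v (\<Phi> k (j + 1) *\<^sub>v b j)) k"
  proof (rule vec_sum_cong)
    fix j assume "j < k"
    then show "\<Phi> (Suc k) (j + 1) *\<^sub>v b j = A k *\<^sub>v (\<Phi> k (j + 1) *\<^sub>v b j)"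
      using assoc_mult_mat_vec[OF Amat_carrier trans_carrier b] by (simp add: trans_Suc)
    show "A k *\<^sub>v (\<Phi> k (j + 1) *\<^sub>v b j) \<in> carrier_vec n"
      using Amat_carrier c by (rule mult_mat_vec_carrier)
  qed
  also have "\<dots> = A k *\<^sub>v response b k"
    unfolding response_def by (rule mult_vec_sum[symmetric]) (use c in simp_all)
  also have "b k + A k *\<^sub>v response b k = A k *\<^sub>v response b k + b k"
    by (rule comm_add_vec[OF b mult_mat_vec_carrier[OF Amat_carrier response_carrier[OF b]]])
  finally show ?thesis .
qed

abbreviation "m_pred y \<equiv> pred_mean Q \<theta> u y"
abbreviation "e y k \<equiv> y k - C *\<^sub>v m_pred y k"
abbreviation "correction y k \<equiv> A k *\<^sub>v (L k *\<^sub>v e y k)"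

text \<open>A difference of vectors takes its dimension from the subtrahend, so this holds at all
  times, even beyond the horizon where \<open>y\<close> is unconstrained.\<close>

lemma e_carrier: "e y k \<in> carrier_vec d"
  by (intro carrier_vecI) (simp add: carrier_matD(1)[OF Cmat_carrier])

lemma correction_carrier: "correction y k \<in> carrier_vec n"
  by (rule mult_mat_vec_carrier[OF Amat_carrier mult_mat_vec_carrier[OF gain_carrier e_carrier]])

text \<open>Superposition: the predictor obeys the system dynamics with inputs \<open>B k\<close>
  and \<open>correction y k\<close>. The innovations on the right still contain
  \<open>m_pred\<close>; an implicit identity suffices, because \<open>T\<close> is applied to these
  same innovations.\<close>

lemma pred_mean_eq:
  "m_pred y k = \<Phi> k 0 *\<^sub>v m0 Q \<theta> + response (\<lambda>j. B j) k + response (correction y) k"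
proof (induction k)
  case 0
  show ?case by (simp add: pred_mean.simps response_def trans_self)
next
  case (Suc k)
  let ?a = "\<Phi> k 0 *\<^sub>v m0 Q \<theta>" and ?r = "response (\<lambda>j. B j) k" and ?c = "response (correction y) k"
  let ?l = "L k *\<^sub>v e y k"
  have c: "?a \<in> carrier_vec n" "?r \<in> carrier_vec n" "?c \<in> carrier_vec n" "?l \<in> carrier_vec n"
    by (rule mult_mat_vec_carrier[OF trans_carrier m0_carrier] response_carrier[OF Bvec_carrier]
        response_carrier[OF correction_carrier] mult_mat_vec_carrier[OF gain_carrier e_carrier])+
  note Ac = mult_mat_vec_carrier[OF Amat_carrier c(1), of k] mult_mat_vec_carrier[OF Amat_carrier c(2), of k]
    mult_mat_vec_carrier[OF Amat_carrier c(3), of k] mult_mat_vec_carrier[OF Amat_carrier c(4), of k]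
  have regroup: "v\<^sub>1 + v\<^sub>2 + v\<^sub>3 + v\<^sub>4 + v\<^sub>5 = v\<^sub>1 + (v\<^sub>2 + v\<^sub>5) + (v\<^sub>3 + v\<^sub>4)"
    if "v\<^sub>1 \<in> carrier_vec n" "v\<^sub>2 \<in> carrier_vec n" "v\<^sub>3 \<in> carrier_vec n" "v\<^sub>4 \<in> carrier_vec n"
      "v\<^sub>5 \<in> carrier_vec n" for v\<^sub>1 v\<^sub>2 v\<^sub>3 v\<^sub>4 v\<^sub>5 :: "real vec"
    using that by (intro eq_vecI) simp_all
  have "m_pred y (Suc k) = A k *\<^sub>v (?a + ?r + ?c + ?l) + B k"
    by (simp only: pred_mean.simps filt_mean.simps Suc[symmetric])
  also have "A k *\<^sub>v (?a + ?r + ?c + ?l) = A k *\<^sub>v ?a + A k *\<^sub>v ?r + A k *\<^sub>v ?c + A k *\<^sub>v ?l"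
    unfolding mult_add_distrib_mat_vec[OF Amat_carrier add_carrier_vec[OF add_carrier_vec[OF c(1,2)] c(3)] c(4)]
      mult_add_distrib_mat_vec[OF Amat_carrier add_carrier_vec[OF c(1,2)] c(3)]
      mult_add_distrib_mat_vec[OF Amat_carrier c(1,2)] ..
  also have "\<dots> + B k = A k *\<^sub>v ?a + (A k *\<^sub>v ?r + B k) + (A k *\<^sub>v ?c + A k *\<^sub>v ?l)"
    using Ac Bvec_carrier by (rule regroup)
  also have "\<dots> = \<Phi> (Suc k) 0 *\<^sub>v m0 Q \<theta> + response (\<lambda>j. B j) (Suc k) + response (correction y) (Suc k)"
    unfolding response_Suc[OF Bvec_carrier] response_Suc[of "correction y" k, OF correction_carrier]
    using assoc_mult_mat_vec[OF Amat_carrier trans_carrier m0_carrier] by (simp add: trans_Suc)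
  finally show ?case .
qed

text \<open>Block \<open>k\<close> is \<open>C\<close> applied to the first two terms of
  \<open>pred_mean_eq\<close>, that is, to the mean propagated without measurements.\<close>

lemma F_mean_blocks:
  "F_mean Q N \<theta> u =
    col_stack (N + 1) d (\<lambda>k. C *\<^sub>v (\<Phi> k 0 *\<^sub>v m0 Q \<theta>) + C *\<^sub>v response (\<lambda>j. B j) k)"
proof -
  let ?K = "N + 1"
  have PM: "\<Phi> k 0 *\<^sub>v m0 Q \<theta> \<in> carrier_vec n" for k
    by (rule mult_mat_vec_carrier[OF trans_carrier m0_carrier])
  have "stacked_A Q N \<theta> u *\<^sub>v m0 Q \<theta> =
      blocks_mat ?K 1 n n (\<lambda>k _. \<Phi> k 0) *\<^sub>v col_stack 1 n (\<lambda>_. m0 Q \<theta>)"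
    by (simp only: stacked_A_def col_stack_single[OF m0_carrier])
  also have "\<dots> = col_stack ?K n (\<lambda>k. vec_sum n (\<lambda>j. \<Phi> k 0 *\<^sub>v m0 Q \<theta>) 1)"
    by (rule blocks_mat_mult_vec) simp_all
  also have "\<dots> = col_stack ?K n (\<lambda>k. \<Phi> k 0 *\<^sub>v m0 Q \<theta>)"
    by (intro col_stack_cong vec_sum_1 PM)
  finally have Am: "stacked_A Q N \<theta> u *\<^sub>v m0 Q \<theta> = col_stack ?K n (\<lambda>k. \<Phi> k 0 *\<^sub>v m0 Q \<theta>)" .
  have "stacked_A Q N \<theta> u \<in> carrier_mat (?K * n) n"
    using blocks_mat_carrier[of ?K 1 n n] by (simp add: stacked_A_def)
  then have "stacked_C Q N * stacked_A Q N \<theta> u *\<^sub>v m0 Q \<theta> = stacked_C Q N *\<^sub>v (stacked_A Q N \<theta> u *\<^sub>v m0 Q \<theta>)"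
    by (rule assoc_mult_mat_vec[OF stacked_C_carrier _ m0_carrier])
  also have "\<dots> = col_stack ?K d (\<lambda>k. C *\<^sub>v (\<Phi> k 0 *\<^sub>v m0 Q \<theta>))"
    unfolding Am stacked_C_def by (rule kron_mult_col_stack[OF PM Cmat_carrier])
  finally have 1: "stacked_C Q N * stacked_A Q N \<theta> u *\<^sub>v m0 Q \<theta> =
      col_stack ?K d (\<lambda>k. C *\<^sub>v (\<Phi> k 0 *\<^sub>v m0 Q \<theta>))" .
  have "stacked_B Q N \<theta> u = col_stack ?K n (response (\<lambda>j. B j))"
    unfolding stacked_B_def response_def vec_sum_def ..
  then have 2: "stacked_C Q N *\<^sub>v stacked_B Q N \<theta> u = col_stack ?K d (\<lambda>k. C *\<^sub>v response (\<lambda>j. B j) k)"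
    unfolding stacked_C_def using kron_mult_col_stack[OF response_carrier[OF Bvec_carrier] Cmat_carrier] by simp
  show ?thesis
    unfolding F_mean_def 1 2
    by (rule col_stack_add) (rule mult_mat_vec_carrier[OF Cmat_carrier response_carrier[OF Bvec_carrier]])
qed

lemma T_mat_mult_innovations:
  "T_mat N *\<^sub>v col_stack (N + 1) d (e y) =
    col_stack (N + 1) d (\<lambda>k. e y k + C *\<^sub>v response (correction y) k)"
proof -
  let ?K = "N + 1"
  have c: "T k j *\<^sub>v e y j \<in> carrier_vec d" for k j
    by (rule mult_mat_vec_carrier[OF T_carrier e_carrier])
  have Pc: "\<Phi> k i *\<^sub>v correction y j \<in> carrier_vec n" for k i j
    by (rule mult_mat_vec_carrier[OF trans_carrier correction_carrier])
  have "T_mat N *\<^sub>v col_stack ?K d (e y) = col_stack ?K d (\<lambda>k. vec_sum d (\<lambda>j. T k j *\<^sub>v e y j) ?K)"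
    by (rule blocks_mat_mult_vec[OF T_carrier e_carrier])
  also have "\<dots> = col_stack ?K d (\<lambda>k. e y k + C *\<^sub>v response (correction y) k)"
  proof (rule col_stack_cong)
    fix k assume k: "k < ?K"
    have "vec_sum d (\<lambda>j. T k j *\<^sub>v e y j) ?K = vec_sum d (\<lambda>j. T k j *\<^sub>v e y j) (Suc k)"
    proof (rule vec_sum_truncate)
      fix j assume "Suc k \<le> j"
      then have "T k j = 0\<^sub>m d d" by (simp add: T_def)
      then show "T k j *\<^sub>v e y j = 0\<^sub>v d"
        using carrier_vecD[OF e_carrier[of y j]] by (intro eq_vecI) (auto simp: scalar_prod_def)
    qed (use k c in simp_all)
    also have "\<dots> = T k k *\<^sub>v e y k + vec_sum d (\<lambda>j. T k j *\<^sub>v e y j) k"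
      using c by (rule vec_sum_Suc)
    also have "T k k *\<^sub>v e y k = e y k"
      using one_mult_mat_vec[OF e_carrier] by (simp add: T_def)
    also have "vec_sum d (\<lambda>j. T k j *\<^sub>v e y j) k = vec_sum d (\<lambda>j. C *\<^sub>v (\<Phi> k (j + 1) *\<^sub>v correction y j)) k"
    proof (rule vec_sum_cong)
      fix j assume "j < k"
      then have "T k j = C * (\<Phi> k (j + 1) * (A j * L j))" by (simp add: T_def)
      then show "T k j *\<^sub>v e y j = C *\<^sub>v (\<Phi> k (j + 1) *\<^sub>v correction y j)"
        using Cmat_carrier trans_carrier[of k "j + 1"] Amat_carrier[of j] gain_carrier[of j] e_carrier[of y j]
        by (simp only: mat_dim_simps)
      show "C *\<^sub>v (\<Phi> k (j + 1) *\<^sub>v correction y j) \<in> carrier_vec d"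
        using Cmat_carrier Pc by (rule mult_mat_vec_carrier)
    qed
    also have "\<dots> = C *\<^sub>v response (correction y) k"
      unfolding response_def by (rule mult_vec_sum[OF Cmat_carrier Pc, symmetric])
    finally show "vec_sum d (\<lambda>j. T k j *\<^sub>v e y j) ?K = e y k + C *\<^sub>v response (correction y) k" .
  qed
  finally show ?thesis .
qed

text \<open>Block \<open>k\<close> of the residual is the innovation plus \<open>C\<close> times the
  gap between the predicted mean and the uncorrected one. By \<open>pred_mean_eq\<close> this gap is
  the response to the corrections, and \<open>T\<close> produces the same sum.\<close>

lemma residual_factorization:
  assumes y: "\<And>k. k \<le> N \<Longrightarrow> y k \<in> carrier_vec d"
  shows "col_stack (N + 1) d y - F_mean Q N \<theta> u = T_mat N *\<^sub>v col_stack (N + 1) d (e y)"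
proof -
  have c: "C *\<^sub>v (\<Phi> k 0 *\<^sub>v m0 Q \<theta>) \<in> carrier_vec d" "C *\<^sub>v response (\<lambda>j. B j) k \<in> carrier_vec d"
    "C *\<^sub>v response (correction y) k \<in> carrier_vec d" for k
    by (rule mult_mat_vec_carrier[OF Cmat_carrier] mult_mat_vec_carrier[OF trans_carrier m0_carrier]
        response_carrier[OF Bvec_carrier] response_carrier[OF correction_carrier])+
  have "col_stack (N + 1) d y - F_mean Q N \<theta> u = col_stack (N + 1) d
      (\<lambda>k. y k - (C *\<^sub>v (\<Phi> k 0 *\<^sub>v m0 Q \<theta>) + C *\<^sub>v response (\<lambda>j. B j) k))"
    unfolding F_mean_blocks using c by (intro col_stack_minus) simp
  also have "\<dots> = col_stack (N + 1) d (\<lambda>k. e y k + C *\<^sub>v response (correction y) k)"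
  proof (rule col_stack_cong)
    fix k assume "k < N + 1"
    then have yk: "y k \<in> carrier_vec d" by (intro y) simp
    let ?a = "\<Phi> k 0 *\<^sub>v m0 Q \<theta>" and ?r = "response (\<lambda>j. B j) k" and ?c = "response (correction y) k"
    have x: "?a \<in> carrier_vec n" "?r \<in> carrier_vec n" "?c \<in> carrier_vec n"
      by (rule mult_mat_vec_carrier[OF trans_carrier m0_carrier] response_carrier[OF Bvec_carrier]
          response_carrier[OF correction_carrier])+
    have "C *\<^sub>v m_pred y k = C *\<^sub>v (?a + ?r + ?c)"
      by (rule arg_cong[OF pred_mean_eq])
    also have "\<dots> = C *\<^sub>v ?a + C *\<^sub>v ?r + C *\<^sub>v ?c"
      unfolding mult_add_distrib_mat_vec[OF Cmat_carrier add_carrier_vec[OF x(1,2)] x(3)]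
        mult_add_distrib_mat_vec[OF Cmat_carrier x(1,2)] ..
    finally have "C *\<^sub>v m_pred y k = C *\<^sub>v ?a + C *\<^sub>v ?r + C *\<^sub>v ?c" .
    then show "y k - (C *\<^sub>v (\<Phi> k 0 *\<^sub>v m0 Q \<theta>) + C *\<^sub>v response (\<lambda>j. B j) k) =
        e y k + C *\<^sub>v response (correction y) k"
      using yk c[of k] by (intro eq_vecI) simp_all
  qed
  finally show ?thesis unfolding T_mat_mult_innovations .
qed

lemma wnorm_sq_S_cov:
  assumes y: "\<And>k. k \<le> N \<Longrightarrow> y k \<in> carrier_vec d"
  shows "wnorm_sq (inv_mat (S_cov Q N \<theta> u)) (col_stack (N + 1) d y - F_mean Q N \<theta> u) =
    (\<Sum>k = 0..N. wnorm_sq (inv_mat (\<Sigma> k)) (e y k))"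
proof -
  let ?K = "N + 1"
  \<comment> \<open>Blockwise solution of \<open>D w = e\<close>, the witness required by
    \<open>wnorm_sq_inv_factorized\<close>.\<close>
  let ?w = "\<lambda>k. inv_mat (\<Sigma> k) *\<^sub>v e y k"
  note i = inv_mat_props[OF innov_cov_carrier innov_cov_det]
  have wc: "?w k \<in> carrier_vec d" for k
    by (rule mult_mat_vec_carrier[OF i(1) e_carrier])
  have Sw: "\<Sigma> k *\<^sub>v ?w k = e y k" for k
    using assoc_mult_mat_vec[OF innov_cov_carrier i(1) e_carrier, of k k y k]
      one_mult_mat_vec[OF e_carrier] by (simp add: i(2))
  have "D_mat N *\<^sub>v col_stack ?K d ?w = col_stack ?K d (\<lambda>k. \<Sigma> k *\<^sub>v ?w k)"
    by (rule blocks_diag_mult_vec) (rule wc, rule innov_cov_carrier)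
  then have Dw: "D_mat N *\<^sub>v col_stack ?K d ?w = col_stack ?K d (e y)"
    by (simp only: Sw)
  have dT: "det (T_mat N) \<noteq> 0" unfolding det_T_mat by simp
  have dD: "det (D_mat N) \<noteq> 0" unfolding det_D_mat by (simp add: innov_cov_det)
  have res: "col_stack ?K d y - F_mean Q N \<theta> u = T_mat N *\<^sub>v col_stack ?K d (e y)"
    using y by (rule residual_factorization)
  have "wnorm_sq (inv_mat (S_cov Q N \<theta> u)) (col_stack ?K d y - F_mean Q N \<theta> u) =
      col_stack ?K d (e y) \<bullet> col_stack ?K d ?w"
    unfolding res S_cov_factorization
    by (rule wnorm_sq_inv_factorized[OF blocks_mat_carrier dT blocks_mat_carrier dD
          col_stack_carrier col_stack_carrier Dw])
  also have "\<dots> = (\<Sum>k<?K. e y k \<bullet> ?w k)"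
    by (rule scalar_prod_col_stack[OF wc])
  finally show ?thesis
    by (simp add: wnorm_sq_def lessThan_Suc_atMost atLeast0AtMost)
qed

end

section \<open>The likelihood identities\<close>

theorem lemma3:
  fixes Q :: "'u qlsys" and N :: nat and \<theta> :: "real vec"
    and u :: "nat \<Rightarrow> 'u" and y :: "nat \<Rightarrow> real vec" and Y :: "real vec"
  assumes sys: "wf_qlsys Q"
    and N: "1 \<le> N"
    and theta: "\<theta> \<in> Theta Q"
    and y: "\<And>k. k \<le> N \<Longrightarrow> y k \<in> carrier_vec (dim_y Q)"
    and Y: "Y = col_stack (N + 1) (dim_y Q) y"
  shows
    "obs_density Q N \<theta> u Y =
       (\<Prod>k = 0..N. gauss_density (y k) (Cmat Q *\<^sub>v pred_mean Q \<theta> u y k) (innov_cov Q \<theta> u k)) \<and>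
     wnorm_sq (inv_mat (S_cov Q N \<theta> u)) (Y - F_mean Q N \<theta> u) =
       (\<Sum>k = 0..N. wnorm_sq (inv_mat (innov_cov Q \<theta> u k))
                        (y k - Cmat Q *\<^sub>v pred_mean Q \<theta> u y k)) \<and>
     det (S_cov Q N \<theta> u) = (\<Prod>k = 0..N. det (innov_cov Q \<theta> u k)) \<and>
     (0 < prior Q \<theta> \<longrightarrow> neg_log_post Q N \<theta> Y u =
       1 / 2 * (\<Sum>k = 0..N.
                  wnorm_sq (inv_mat (innov_cov Q \<theta> u k)) (y k - Cmat Q *\<^sub>v pred_mean Q \<theta> u y k)
                  + ln (det (innov_cov Q \<theta> u k)))
       - ln (prior Q \<theta>))"
proof -
  interpret quasi_linear_system Q \<theta> u by unfold_locales (fact sys theta)+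
  have norm: "wnorm_sq (inv_mat (S_cov Q N \<theta> u)) (Y - F_mean Q N \<theta> u) =
      (\<Sum>k = 0..N. wnorm_sq (inv_mat (\<Sigma> k)) (e y k))"
    unfolding Y using y by (rule wnorm_sq_S_cov)
  \<comment> \<open>Writing \<open>N + 1\<close> as \<open>card {0..N}\<close> brings the
    normalizing power of 2 pi into the form of \<open>prod_gauss_density\<close>.\<close>
  have dim: "dim_vec Y = card {0..N} * d" by (simp only: Y col_stack_dim card_atLeastAtMost Suc_eq_plus1 diff_zero)
  have "obs_density Q N \<theta> u Y = (\<Prod>k = 0..N. gauss_density (y k) (C *\<^sub>v m_pred y k) (\<Sigma> k))"
    unfolding obs_density_def gauss_density_def[of Y] norm det_S_cov dim
    by (rule prod_gauss_density[symmetric]) (use y in simp)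
  moreover have "ln (det (S_cov Q N \<theta> u)) = (\<Sum>k = 0..N. ln (det (\<Sigma> k)))"
    unfolding det_S_cov by (rule ln_prod) (simp_all add: innov_cov_det)
  ultimately show ?thesis
    using norm det_S_cov by (simp add: neg_log_post_def sum.distrib distrib_left)
qed

end
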